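(* Let $(X,\rho,\mu)$ be a metric measure space and let $N$ be a non-negative integer. Suppose that the module of derivations $\mathrm{Der}(X,\mu)$ has index locally bounded by $N$. Then there is a measurable partition $$X=X_0\sqcup X_1\sqcup\cdots\sqcup X_N\sqcup\Omega$$ such that $\mu(\Omega)=0$ and, for each $i\in\{0,\dots,N\}$ with $X_i\neq\emptyset$, the $L^\infty(X_i,\mu)$-module $\mathrm{Der}(X_i,\mu)$ is free of rank $i$.
   Context: A metric measure space $(X,\rho,\mu)$ is a separable metric space with a Borel measure that is finite on bounded sets. $\mathrm{Lip}^\infty(X)$ is the real algebra (pointwise operations) of bounded Lipschitz functions $X\to\mathbb{R}$ with norm $\|f\|=\max(\sup|f|,\mathbf{L}(f))$, where $\mathbf{L}(f)$ is the global Lipschitz constant. It is a dual Banach space with unique predual (the closed linear span of the point evaluations in $\mathrm{Lip}^\infty(X)^*$), and "weak* topology" refers to this predual; a sequence $f_n$ converges weak* to $f$ iff $\sup_n\|f_n\|<\infty$ and $f_n\to f$ pointwise. A derivation is a bounded linear map $D:\mathrm{Lip}^\infty(X)\to L^\infty(X,\mu)$ with $D(fg)=(Df)\,g+f\,(Dg)$ a.e. for all $f,g$, and such that $f_n\to f$ weak* in $\mathrm{Lip}^\infty(X)$ implies $Df_n\to Df$ weak* in $L^\infty(X,\mu)$ (as the dual of $L^1(X,\mu)$). The derivations form an $L^\infty(X,\mu)$-module $\mathrm{Der}(X,\mu)$. For measurable $U\subset X$, $\mathrm{Der}(U,\mu)$ is the $L^\infty(U,\mu)$-module of derivations of $U$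 with the restricted metric and measure. Derivations $D_1,\dots,D_n\in\mathrm{Der}(U,\mu)$ are linearly independent (over $L^\infty(U,\mu)$) if $\sum_i\lambda_iD_i=0$ with $\lambda_i\in L^\infty(U,\mu)$ implies that all $\lambda_i=0$ a.e. $\mathrm{Der}(U,\mu)$ has finite index if there is $K$ such that every linearly independent set in it has at most $K$ elements; the smallest such $K$ is its index. $\mathrm{Der}(X,\mu)$ has index locally bounded by $N$ if for every measurable $U\subset X$ with $\mu(U)>0$, $\mathrm{Der}(U,\mu)$ has index at most $N$. *)

theory Defs
  imports "HOL-Analysis.Analysis"
begin

text \<open>
  A metric measure space is a measure \<open>M\<close> whose points \<open>space M\<close> form a subset of a metric type,
  with the induced metric; a measurable subset \<open>U\<close> with restricted metric and measure is then
  \<open>restrict_space M U\<close>. ``Measurable'' means Borel throughout.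

  Elements of the Lipschitz algebra are functions on the ambient type of which only the values on
  \<open>space M\<close> matter, and elements of \<open>L\<^sup>\<infinity>\<close> are represented by functions, equality in
  \<open>L\<^sup>\<infinity>\<close> being equality almost everywhere.
\<close>

definition metric_measure_space :: "'a::metric_space measure \<Rightarrow> bool" where
  "metric_measure_space M \<longleftrightarrow>
     separable_space (top_of_set (space M)) \<and>
     sets M = sets (restrict_space borel (space M)) \<and>
     (\<forall>A\<in>sets M. bounded A \<longrightarrow> emeasure M A < \<infinity>)"

definition Lip_inf :: "'a::metric_space measure \<Rightarrow> ('a \<Rightarrow> real) set" where
  "Lip_inf M = {f. bounded (f ` space M) \<and> (\<exists>L. L-lipschitz_on (space M) f)}"

definition lip_const :: "'a::metric_space measure \<Rightarrow> ('a \<Rightarrow> real) \<Rightarrow> real" where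
  "lip_const M f = Inf {L. L-lipschitz_on (space M) f}"

definition lip_norm :: "'a::metric_space measure \<Rightarrow> ('a \<Rightarrow> real) \<Rightarrow> real" where
  "lip_norm M f = max (SUP x\<in>space M. \<bar>f x\<bar>) (lip_const M f)"

text \<open>
  The predual of the Lipschitz algebra: functionals that are limits, in the norm of its dual, of
  finite linear combinations of point evaluations. (Linearity and boundedness on \<open>Lip_inf M\<close>
  are automatic for such limits; values outside \<open>Lip_inf M\<close> are irrelevant.)
\<close>

definition lip_predual :: "'a::metric_space measure \<Rightarrow> (('a \<Rightarrow> real) \<Rightarrow> real) set" where
  "lip_predual M = {\<phi>. \<forall>\<epsilon>>0. \<exists>F a. finite F \<and> F \<subseteq> space M \<and>
     (\<forall>f\<in>Lip_inf M. \<bar>\<phi> f - (\<Sum>x\<in>F. a x * f x)\<bar> \<le> \<epsilon> * lip_norm M f)}"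

definition lip_weak_star_tendsto ::
    "'a::metric_space measure \<Rightarrow> (nat \<Rightarrow> 'a \<Rightarrow> real) \<Rightarrow> ('a \<Rightarrow> real) \<Rightarrow> bool" where
  "lip_weak_star_tendsto M f g \<longleftrightarrow> (\<forall>\<phi>\<in>lip_predual M. (\<lambda>n. \<phi> (f n)) \<longlonglongrightarrow> \<phi> g)"

definition L_inf :: "'a measure \<Rightarrow> ('a \<Rightarrow> real) set" where
  "L_inf M = {u. u \<in> borel_measurable M \<and> (\<exists>C. AE x in M. \<bar>u x\<bar> \<le> C)}"

definition L_inf_weak_star_tendsto ::
    "'a measure \<Rightarrow> (nat \<Rightarrow> 'a \<Rightarrow> real) \<Rightarrow> ('a \<Rightarrow> real) \<Rightarrow> bool" where
  "L_inf_weak_star_tendsto M u v \<longleftrightarrow>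
     (\<forall>h. integrable M h \<longrightarrow>
        (\<lambda>n. integral\<^sup>L M (\<lambda>x. u n x * h x)) \<longlonglongrightarrow> integral\<^sup>L M (\<lambda>x. v x * h x))"

type_synonym 'a lip_operator = "('a \<Rightarrow> real) \<Rightarrow> ('a \<Rightarrow> real)"

text \<open>
  The four clauses after the first are linearity, boundedness (stated through the essential
  supremum bound), the Leibniz rule, and weak* continuity. Linearity and boundedness imply
  that, up to null sets, \<open>D f\<close> depends only on the values of \<open>f\<close> on \<open>space M\<close>.
\<close>

definition Der :: "'a::metric_space measure \<Rightarrow> 'a lip_operator set" where
  "Der M = {D.
     (\<forall>f\<in>Lip_inf M. D f \<in> L_inf M) \<and>
     (\<forall>f\<in>Lip_inf M. \<forall>g\<in>Lip_inf M. \<forall>a b.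
        AE x in M. D (\<lambda>y. a * f y + b * g y) x = a * D f x + b * D g x) \<and>
     (\<exists>C. \<forall>f\<in>Lip_inf M. AE x in M. \<bar>D f x\<bar> \<le> C * lip_norm M f) \<and>
     (\<forall>f\<in>Lip_inf M. \<forall>g\<in>Lip_inf M.
        AE x in M. D (\<lambda>y. f y * g y) x = D f x * g x + f x * D g x) \<and>
     (\<forall>f g. (\<forall>n. f n \<in> Lip_inf M) \<and> g \<in> Lip_inf M \<and> lip_weak_star_tendsto M f g \<longrightarrow>
        L_inf_weak_star_tendsto M (\<lambda>n. D (f n)) (D g))}"

definition der_eq :: "'a::metric_space measure \<Rightarrow> 'a lip_operator \<Rightarrow> 'a lip_operator \<Rightarrow> bool" where
  "der_eq M D E \<longleftrightarrow> (\<forall>f\<in>Lip_inf M. AE x in M. D f x = E f x)"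

definition der_lincomb ::
    "nat \<Rightarrow> (nat \<Rightarrow> 'a \<Rightarrow> real) \<Rightarrow> (nat \<Rightarrow> 'a lip_operator) \<Rightarrow> 'a lip_operator" where
  "der_lincomb n c D = (\<lambda>f x. \<Sum>i<n. c i x * D i f x)"

definition der_independent ::
    "'a::metric_space measure \<Rightarrow> nat \<Rightarrow> (nat \<Rightarrow> 'a lip_operator) \<Rightarrow> bool" where
  "der_independent M n D \<longleftrightarrow>
     (\<forall>c. (\<forall>i<n. c i \<in> L_inf M) \<and> der_eq M (der_lincomb n c D) (\<lambda>f x. 0) \<longrightarrow>
        (\<forall>i<n. AE x in M. c i x = 0))"

text \<open>
  A finite set of \<open>n\<close> elements of the module is given by representatives
  \<open>D 0, \<dots>, D (n - 1)\<close> that are pairwise distinct modulo \<open>der_eq\<close>. An infinite linearly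
  independent set would contain finite ones of every size, so finite sets suffice.
\<close>

definition der_index_bound :: "'a::metric_space measure \<Rightarrow> nat \<Rightarrow> bool" where
  "der_index_bound M K \<longleftrightarrow>
     (\<forall>n D. (\<forall>i<n. D i \<in> Der M) \<and> (\<forall>i<n. \<forall>j<n. i \<noteq> j \<longrightarrow> \<not> der_eq M (D i) (D j)) \<and>
        der_independent M n D \<longrightarrow> n \<le> K)"

definition der_finite_index :: "'a::metric_space measure \<Rightarrow> bool" where
  "der_finite_index M \<longleftrightarrow> (\<exists>K. der_index_bound M K)"

definition der_index :: "'a::metric_space measure \<Rightarrow> nat" where
  "der_index M = (LEAST K. der_index_bound M K)"

definition der_index_locally_bounded :: "'a::metric_space measure \<Rightarrow> nat \<Rightarrow> bool" where
  "der_index_locally_bounded M N \<longleftrightarrow>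
     (\<forall>U\<in>sets M. emeasure M U > 0 \<longrightarrow>
        der_finite_index (restrict_space M U) \<and> der_index (restrict_space M U) \<le> N)"

text \<open>Free of rank \<open>n\<close>: there is a basis (an independent generating family) of length \<open>n\<close>.\<close>

definition der_free_of_rank :: "'a::metric_space measure \<Rightarrow> nat \<Rightarrow> bool" where
  "der_free_of_rank M n \<longleftrightarrow>
     (\<exists>D. (\<forall>i<n. D i \<in> Der M) \<and> der_independent M n D \<and>
        (\<forall>E\<in>Der M. \<exists>c. (\<forall>i<n. c i \<in> L_inf M) \<and> der_eq M E (der_lincomb n c D)))"

end

theory Submission
  imports Defs "HOL-Complex_Analysis.Great_Picard"
begin

text \<open>
  The core of the argument is local. Call derivations \<open>D\<^sub>1, \<dots>, D\<^sub>k\<close> and Lipschitz functions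
  \<open>f\<^sub>1, \<dots>, f\<^sub>k\<close> of norm at most \<open>1\<close> a frame on \<open>V\<close> if \<open>D\<^sub>i f\<^sub>j = \<delta>\<^sub>i\<^sub>j\<close> a.e. on \<open>V\<close> and the \<open>D\<^sub>i\<close> are
  bounded by \<open>3\<^sup>k\<close> on the unit ball there. A linear combination of the \<open>D\<^sub>i\<close>, applied to
  \<open>f\<^sub>j\<close>, yields its \<open>j\<close>-th coefficient, so the \<open>D\<^sub>i\<close> are linearly independent on \<open>V\<close>, and
  \<open>k \<le> N\<close> if \<open>V\<close> has positive measure (\<open>der_frame_length_le\<close>). A frame of
  maximal length among the subsets of positive measure of a given set spans: if some
  \<open>E' = E - \<Sum> E (f\<^sub>j) D\<^sub>j\<close> is not zero on \<open>V\<close>, then some \<open>E' h\<close> is bounded away from zero on some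
  \<open>W \<subseteq> V\<close> of positive measure, and division by \<open>E' h\<close> produces a longer frame on \<open>W\<close> (\<open>der_frame_extend\<close>). Because of the
  dual functions the coefficients of \<open>E\<close> are the bounded functions \<open>E (f\<^sub>j)\<close>.

  Hence every set of positive measure contains one of positive measure with a spanning frame, and
  by exhaustion (\<open>disjoint_cover_if_locally_exists\<close>) almost all of the space is a countable
  disjoint union of such sets. Let \<open>X\<^sub>i\<close> be the union of those with frames of length \<open>i\<close>. The functions
  \<open>f\<^sub>j\<close> on different pieces need not fit together to a Lipschitz function, but the derivations do
  fit together to derivations because their bounds are uniform (\<open>Der_piecewise\<close>), and
  so do the coefficients \<open>E (f\<^sub>j)\<close>, since \<open>E\<close> is bounded and the \<open>f\<^sub>j\<close> lie in the unit ball. So the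
  glued derivations are a basis on \<open>X\<^sub>i\<close> (\<open>der_free_of_rank_if_frames\<close>).

  All this takes place among derivations of the whole space. Derivations of a measurable
  subset extend by zero (\<open>Der_extend_zero\<close>). Conversely, derivations restrict to
  subsets (\<open>Der_restrict\<close>), because they are local: \<open>D f\<close> on \<open>U\<close> depends only on \<open>f\<close> on \<open>U\<close>
  (\<open>Der_local\<close>). Weak* continuity is always used and verified for bounded pointwise convergent
  sequences; that weak* convergent sequences are bounded is the uniform boundedness principle
  for the predual (\<open>lip_weak_star_convergent_bounded\<close>).
\<close>

section \<open>Balls of the Lipschitz algebra and weak* convergence\<close>

text \<open>
  For a nonempty space this is the closed ball of radius \<open>K\<close>. Unlike \<open>lip_norm\<close>, whose supremum is
  an arbitrary constant on the empty space, it needs no case distinction.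
\<close>

definition lip_ball :: "'a::metric_space measure \<Rightarrow> real \<Rightarrow> ('a \<Rightarrow> real) set" where
  "lip_ball M K = {f. (\<forall>x\<in>space M. \<bar>f x\<bar> \<le> K) \<and> K-lipschitz_on (space M) f}"

lemma lip_ballI:
  assumes "0 \<le> K" "\<And>x. x \<in> space M \<Longrightarrow> \<bar>f x\<bar> \<le> K"
    "\<And>x y. x \<in> space M \<Longrightarrow> y \<in> space M \<Longrightarrow> \<bar>f x - f y\<bar> \<le> K * dist x y"
  shows "f \<in> lip_ball M K"
  using assms by (auto simp: lip_ball_def dist_real_def intro!: lipschitz_onI)

lemma lip_ballD:
  assumes "f \<in> lip_ball M K"
  shows "0 \<le> K" "\<And>x. x \<in> space M \<Longrightarrow> \<bar>f x\<bar> \<le> K"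
    "\<And>x y. x \<in> space M \<Longrightarrow> y \<in> space M \<Longrightarrow> \<bar>f x - f y\<bar> \<le> K * dist x y"
  using assms by (auto simp: lip_ball_def dist_real_def lipschitz_on_def)

lemma lip_ball_mono: "f \<in> lip_ball M K \<Longrightarrow> K \<le> K' \<Longrightarrow> f \<in> lip_ball M K'"
  unfolding lip_ball_def by (auto intro: lipschitz_on_mono order_trans)

lemma Lip_inf_iff: "f \<in> Lip_inf M \<longleftrightarrow> (\<exists>K. f \<in> lip_ball M K)"
proof
  assume "f \<in> Lip_inf M"
  then obtain B L where B: "\<And>x. x \<in> space M \<Longrightarrow> \<bar>f x\<bar> \<le> B" and L: "L-lipschitz_on (space M) f"
    by (auto simp: Lip_inf_def bounded_real)
  have "f \<in> lip_ball M (max B L)"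
    unfolding lip_ball_def using B L
    by (auto intro: lipschitz_on_mono[OF L] simp: le_max_iff_disj)
  then show "\<exists>K. f \<in> lip_ball M K" by blast
next
  assume "\<exists>K. f \<in> lip_ball M K"
  then show "f \<in> Lip_inf M"
    by (auto simp: Lip_inf_def lip_ball_def bounded_real)
qed

lemma Lip_infI: "f \<in> lip_ball M K \<Longrightarrow> f \<in> Lip_inf M"
  by (auto simp: Lip_inf_iff)

lemma lip_ball_lincomb:
  assumes "f \<in> lip_ball M K" "g \<in> lip_ball M L"
  shows "(\<lambda>x. a * f x + b * g x) \<in> lip_ball M (\<bar>a\<bar> * K + \<bar>b\<bar> * L)"
proof (rule lip_ballI)
  show "0 \<le> \<bar>a\<bar> * K + \<bar>b\<bar> * L" using assms[THEN lip_ballD(1)] by simp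
next
  fix x assume "x \<in> space M"
  then have "\<bar>a\<bar> * \<bar>f x\<bar> \<le> \<bar>a\<bar> * K" "\<bar>b\<bar> * \<bar>g x\<bar> \<le> \<bar>b\<bar> * L"
    using assms[THEN lip_ballD(2)] by (auto intro!: mult_left_mono)
  then show "\<bar>a * f x + b * g x\<bar> \<le> \<bar>a\<bar> * K + \<bar>b\<bar> * L"
    using abs_triangle_ineq[of "a * f x" "b * g x"] by (simp add: abs_mult)
next
  fix x y assume xy: "x \<in> space M" "y \<in> space M"
  have "\<bar>a\<bar> * \<bar>f x - f y\<bar> \<le> \<bar>a\<bar> * (K * dist x y)"
    "\<bar>b\<bar> * \<bar>g x - g y\<bar> \<le> \<bar>b\<bar> * (L * dist x y)"
    using assms[THEN lip_ballD(3)] xy by (auto intro!: mult_left_mono)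
  moreover have "\<bar>(a * f x + b * g x) - (a * f y + b * g y)\<bar>
      \<le> \<bar>a\<bar> * \<bar>f x - f y\<bar> + \<bar>b\<bar> * \<bar>g x - g y\<bar>"
    using abs_triangle_ineq[of "a * (f x - f y)" "b * (g x - g y)"]
    by (simp add: abs_mult[symmetric] algebra_simps)
  ultimately show "\<bar>(a * f x + b * g x) - (a * f y + b * g y)\<bar> \<le> (\<bar>a\<bar> * K + \<bar>b\<bar> * L) * dist x y"
    by (simp add: algebra_simps)
qed

lemma lip_ball_mult:
  assumes "f \<in> lip_ball M K" "g \<in> lip_ball M L"
  shows "(\<lambda>x. f x * g x) \<in> lip_ball M (K * L + 2 * K * L)"
proof (rule lip_ballI)
  note nn = assms[THEN lip_ballD(1)]
  then show "0 \<le> K * L + 2 * K * L" by simp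
  fix x assume x: "x \<in> space M"
  have "\<bar>f x\<bar> * \<bar>g x\<bar> \<le> K * L"
    using assms[THEN lip_ballD(2)] nn x by (intro mult_mono) auto
  then show "\<bar>f x * g x\<bar> \<le> K * L + 2 * K * L" using nn
    using mult_nonneg_nonneg[of K L] unfolding abs_mult by linarith
next
  fix x y assume xy: "x \<in> space M" "y \<in> space M"
  note nn = assms[THEN lip_ballD(1)]
  have "f x * g x - f y * g y = f x * (g x - g y) + (f x - f y) * g y" by (simp add: algebra_simps)
  then have "\<bar>f x * g x - f y * g y\<bar> \<le> \<bar>f x\<bar> * \<bar>g x - g y\<bar> + \<bar>f x - f y\<bar> * \<bar>g y\<bar>"
    using abs_triangle_ineq[of "f x * (g x - g y)" "(f x - f y) * g y"] by (simp add: abs_mult)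
  also have "\<dots> \<le> K * (L * dist x y) + (K * dist x y) * L"
    using assms[THEN lip_ballD(2)] assms[THEN lip_ballD(3)] nn xy
    by (intro add_mono mult_mono) auto
  also have "\<dots> \<le> (K * L + 2 * K * L) * dist x y"
    using nn by (simp add: algebra_simps)
  finally show "\<bar>f x * g x - f y * g y\<bar> \<le> (K * L + 2 * K * L) * dist x y" .
qed

lemma Lip_inf_lincomb:
  "f \<in> Lip_inf M \<Longrightarrow> g \<in> Lip_inf M \<Longrightarrow> (\<lambda>x. a * f x + b * g x) \<in> Lip_inf M"
  unfolding Lip_inf_iff using lip_ball_lincomb by blast

lemma Lip_inf_mult:
  "f \<in> Lip_inf M \<Longrightarrow> g \<in> Lip_inf M \<Longrightarrow> (\<lambda>x. f x * g x) \<in> Lip_inf M"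
  unfolding Lip_inf_iff using lip_ball_mult by blast

lemma lip_const_lipschitz:
  assumes "f \<in> Lip_inf M"
  shows "(lip_const M f)-lipschitz_on (space M) f"
proof -
  let ?S = "{L. L-lipschitz_on (space M) f}"
  have ne: "?S \<noteq> {}" using assms by (auto simp: Lip_inf_def)
  show ?thesis
  proof (rule lipschitz_onI)
    show "0 \<le> lip_const M f"
      unfolding lip_const_def by (rule cInf_greatest[OF ne]) (auto simp: lipschitz_on_def)
    fix x y assume xy: "x \<in> space M" "y \<in> space M"
    show "dist (f x) (f y) \<le> lip_const M f * dist x y"
    proof (cases "x = y")
      case False
      have "dist (f x) (f y) / dist x y \<le> lip_const M f"
        unfolding lip_const_def using xy False
        by (intro cInf_greatest[OF ne]) (auto simp: lipschitz_on_def field_simps)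
      with False show ?thesis by (simp add: field_simps)
    qed simp
  qed
qed

lemma lip_ball_lip_norm:
  assumes "f \<in> Lip_inf M" shows "f \<in> lip_ball M (lip_norm M f)"
proof -
  have "bdd_above ((\<lambda>x. \<bar>f x\<bar>) ` space M)"
    using assms by (auto simp: Lip_inf_def bounded_real bdd_above_def)
  then have "\<bar>f x\<bar> \<le> lip_norm M f" if "x \<in> space M" for x
    unfolding lip_norm_def using that cSUP_upper[of x "space M" "\<lambda>x. \<bar>f x\<bar>"] by simp
  moreover have "(lip_norm M f)-lipschitz_on (space M) f"
    by (rule lipschitz_on_le[OF lip_const_lipschitz[OF assms]]) (simp add: lip_norm_def)
  ultimately show ?thesis by (simp add: lip_ball_def)
qed

lemma lip_norm_nonneg: "f \<in> Lip_inf M \<Longrightarrow> 0 \<le> lip_norm M f"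
  by (rule lip_ballD(1)[OF lip_ball_lip_norm])

lemma lip_norm_le:
  assumes "f \<in> lip_ball M K" "space M \<noteq> {}" shows "lip_norm M f \<le> K"
proof -
  have "lip_const M f \<le> K"
    unfolding lip_const_def using assms
    by (intro cInf_lower) (auto simp: lip_ball_def bdd_below_def lipschitz_on_def)
  moreover have "(SUP x\<in>space M. \<bar>f x\<bar>) \<le> K"
    using assms by (intro cSUP_least) (auto simp: lip_ball_def)
  ultimately show ?thesis by (simp add: lip_norm_def)
qed

lemma lip_norm_empty_space:
  assumes "space M = {}" shows "lip_norm M f = lip_norm M g"
  using assms by (simp add: lip_norm_def lip_const_def lipschitz_on_def)

lemma lip_norm_bounded_on_ball: "\<exists>B\<ge>0. \<forall>f\<in>lip_ball M K. lip_norm M f \<le> B"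
proof (cases "space M = {}")
  case True
  have "(\<lambda>_. 0) \<in> lip_ball M 0" by (rule lip_ballI) auto
  then have "0 \<le> lip_norm M (\<lambda>_. 0)" by (intro lip_norm_nonneg Lip_infI)
  then show ?thesis using lip_norm_empty_space[OF True] by (metis order_refl)
next
  case False
  then have "\<forall>f\<in>lip_ball M K. lip_norm M f \<le> \<bar>K\<bar>"
    using lip_norm_le by (metis abs_ge_self order_trans)
  then show ?thesis by (intro exI[of _ "\<bar>K\<bar>"]) auto
qed

definition point_combination :: "'a measure \<Rightarrow> (('a \<Rightarrow> real) \<Rightarrow> real) \<Rightarrow> bool" where
  "point_combination M \<phi> \<longleftrightarrow>
     (\<exists>F a. finite F \<and> F \<subseteq> space M \<and> (\<forall>f. \<phi> f = (\<Sum>x\<in>F. a x * f x)))"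

lemma point_combination_eval: "x \<in> space M \<Longrightarrow> point_combination M (\<lambda>f. f x)"
  unfolding point_combination_def by (intro exI[of _ "{x}"] exI[of _ "\<lambda>_. 1"]) auto

lemma point_combination_zero: "point_combination M (\<lambda>f. 0)"
  unfolding point_combination_def by (intro exI[of _ "{}"]) auto

lemma point_combination_scale:
  "point_combination M \<phi> \<Longrightarrow> point_combination M (\<lambda>f. c * \<phi> f)"
proof -
  assume "point_combination M \<phi>"
  then obtain F a where "finite F" "F \<subseteq> space M" "\<And>f. \<phi> f = (\<Sum>x\<in>F. a x * f x)"
    by (auto simp: point_combination_def)
  then show ?thesis unfolding point_combination_def
    by (intro exI[of _ F] exI[of _ "\<lambda>x. c * a x"]) (auto simp: sum_distrib_left mult.assoc)
qed

lemma point_combination_add: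
  assumes "point_combination M \<phi>" "point_combination M \<psi>"
  shows "point_combination M (\<lambda>f. \<phi> f + \<psi> f)"
proof -
  obtain F a where F: "finite F" "F \<subseteq> space M" "\<And>f. \<phi> f = (\<Sum>x\<in>F. a x * f x)"
    using assms(1) by (auto simp: point_combination_def)
  obtain G b where G: "finite G" "G \<subseteq> space M" "\<And>f. \<psi> f = (\<Sum>x\<in>G. b x * f x)"
    using assms(2) by (auto simp: point_combination_def)
  let ?c = "\<lambda>x. (if x \<in> F then a x else 0) + (if x \<in> G then b x else 0)"
  have "\<phi> f + \<psi> f = (\<Sum>x\<in>F \<union> G. ?c x * f x)" for f
  proof -
    have "\<phi> f = (\<Sum>x\<in>F \<union> G. (if x \<in> F then a x else 0) * f x)"
      unfolding F(3) using F(1) G(1) by (intro sum.mono_neutral_cong_left) auto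
    moreover have "\<psi> f = (\<Sum>x\<in>F \<union> G. (if x \<in> G then b x else 0) * f x)"
      unfolding G(3) using F(1) G(1) by (intro sum.mono_neutral_cong_left) auto
    ultimately show ?thesis by (simp add: sum.distrib distrib_right)
  qed
  then show ?thesis unfolding point_combination_def
    using F G by (intro exI[of _ "F \<union> G"] exI[of _ ?c]) auto
qed

lemma lip_predual_if_approximable:
  assumes "\<And>\<epsilon>. \<epsilon> > 0 \<Longrightarrow>
    \<exists>\<psi>. point_combination M \<psi> \<and> (\<forall>f\<in>Lip_inf M. \<bar>\<phi> f - \<psi> f\<bar> \<le> \<epsilon> * lip_norm M f)"
  shows "\<phi> \<in> lip_predual M"
  unfolding lip_predual_def
proof (intro CollectI allI impI)
  fix \<epsilon> :: real assume "\<epsilon> > 0"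
  from assms[OF this] obtain \<psi> where "point_combination M \<psi>"
    and *: "\<forall>f\<in>Lip_inf M. \<bar>\<phi> f - \<psi> f\<bar> \<le> \<epsilon> * lip_norm M f" by blast
  then obtain F a where "finite F" "F \<subseteq> space M" "\<And>f. \<psi> f = (\<Sum>x\<in>F. a x * f x)"
    by (auto simp: point_combination_def)
  with * show "\<exists>F a. finite F \<and> F \<subseteq> space M \<and>
     (\<forall>f\<in>Lip_inf M. \<bar>\<phi> f - (\<Sum>x\<in>F. a x * f x)\<bar> \<le> \<epsilon> * lip_norm M f)" by fastforce
qed

lemma lip_predual_eval: "x \<in> space M \<Longrightarrow> (\<lambda>f. f x) \<in> lip_predual M"
  by (rule lip_predual_if_approximable)
     (auto intro!: exI[of _ "\<lambda>f. f x"] point_combination_eval mult_nonneg_nonneg lip_norm_nonneg)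

text \<open>The norm of the Lipschitz algebra is almost attained at a point or at a difference quotient.\<close>

lemma norming_point_combination:
  assumes f: "f \<in> Lip_inf M" and ne: "space M \<noteq> {}" and c: "0 \<le> c" "c < lip_norm M f"
  obtains \<psi> where "point_combination M \<psi>" "\<And>h. h \<in> Lip_inf M \<Longrightarrow> \<bar>\<psi> h\<bar> \<le> lip_norm M h"
    "c < \<bar>\<psi> f\<bar>"
proof -
  have "f \<notin> lip_ball M c" using lip_norm_le[OF _ ne] c(2) by fastforce
  then consider x where "x \<in> space M" "c < \<bar>f x\<bar>"
    | x y where "x \<in> space M" "y \<in> space M" "c * dist x y < \<bar>f x - f y\<bar>"
    using lip_ballI[of c M f] c(1) by (meson not_le)
  then show thesis
  proof cases
    case (1 x)
    show thesis
      using 1 by (intro that[of "\<lambda>f. f x"] point_combination_eval lip_ballD(2)[OF lip_ball_lip_norm])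
  next
    case (2 x y)
    have d: "dist x y > 0" using 2(3) by auto
    let ?\<psi> = "\<lambda>f. (1 / dist x y) * (f x + (-1) * f y)"
    show thesis
    proof (rule that[of ?\<psi>])
      show "point_combination M ?\<psi>"
        using 2 by (intro point_combination_scale point_combination_add point_combination_eval)
      show "c < \<bar>?\<psi> f\<bar>" using 2(3) d by (simp add: abs_mult field_simps)
      fix h assume "h \<in> Lip_inf M"
      from lip_ballD(3)[OF lip_ball_lip_norm[OF this] 2(1,2)] d
      show "\<bar>?\<psi> h\<bar> \<le> lip_norm M h" by (simp add: abs_mult field_simps)
    qed
  qed
qed

lemma geometric_increments_tendsto:
  fixes a :: "nat \<Rightarrow> real"
  assumes "\<And>k. \<bar>a (Suc k) - a k\<bar> \<le> c * (1/3) ^ k"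
  shows "\<exists>l. a \<longlonglongrightarrow> l \<and> (\<forall>k. \<bar>a k - l\<bar> \<le> 3/2 * c * (1/3) ^ k)"
proof -
  let ?e = "\<lambda>k. 3/2 * c * (1/3) ^ k :: real"
  have c: "0 \<le> c" using assms[of 0] by simp
  have "(\<lambda>k. (a k - ?e k) - (a k + ?e k)) \<longlonglongrightarrow> 0"
    by (auto intro!: tendsto_eq_intros LIMSEQ_power_zero)
  moreover have "a k - ?e k \<le> a (Suc k) - ?e (Suc k)" "a (Suc k) + ?e (Suc k) \<le> a k + ?e k" for k
    using assms[of k] by (auto simp: abs_le_iff)
  ultimately obtain l where l: "\<And>n. a n - ?e n \<le> l" "\<And>n. l \<le> a n + ?e n"
      "(\<lambda>n. a n - ?e n) \<longlonglongrightarrow> l"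
    using nested_sequence_unique[of "\<lambda>k. a k - ?e k" "\<lambda>k. a k + ?e k"] c by auto
  have "(\<lambda>n. (a n - ?e n) + ?e n) \<longlonglongrightarrow> l + 0"
    by (intro tendsto_add l(3)) (auto intro!: tendsto_eq_intros LIMSEQ_power_zero)
  moreover have "\<bar>a k - l\<bar> \<le> ?e k" for k using l(1)[of k] l(2)[of k] by linarith
  ultimately show ?thesis by auto
qed

text \<open>
  This is the uniform boundedness principle for the predual, by a gliding hump: along an unbounded
  sequence one adds functionals of norm \<open>3\<^sup>-\<^sup>k\<close>, each almost norming a term of norm at least
  \<open>4\<^sup>k\<close>, with the sign for which the previous functional does not cancel it. The later terms
  have total norm at most \<open>3\<^sup>-\<^sup>k/2\<close> and cannot cancel it either, so the limit functional is
  unbounded along the sequence.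
\<close>

lemma lip_weak_star_convergent_bounded:
  assumes f: "\<And>n. f n \<in> Lip_inf M" and lim: "lip_weak_star_tendsto M f g"
  shows "\<exists>K. \<forall>n. lip_norm M (f n) \<le> K"
proof (cases "space M = {}")
  case True
  then have "lip_norm M (f n) \<le> lip_norm M g" for n
    by (rule eq_refl[OF lip_norm_empty_space])
  then show ?thesis by blast
next
  case False
  show ?thesis
  proof (rule ccontr)
    assume "\<nexists>K. \<forall>n. lip_norm M (f n) \<le> K"
    then have unb: "\<exists>n. K < lip_norm M (f n)" for K by (meson not_le)
    define P where "P = (\<lambda>(k::nat) \<phi>. point_combination M \<phi>)"
    define Q where "Q = (\<lambda>k \<phi> \<phi>'. (\<forall>h\<in>Lip_inf M. \<bar>\<phi>' h - \<phi> h\<bar> \<le> (1/3) ^ k * lip_norm M h) \<and>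
       (\<exists>n. 4 ^ k \<le> lip_norm M (f n) \<and> (1/3) ^ k * (3/4 * lip_norm M (f n)) \<le> \<bar>\<phi>' (f n)\<bar>))"
    have "\<exists>\<Phi>. \<forall>k. P k (\<Phi> k) \<and> Q k (\<Phi> k) (\<Phi> (Suc k))"
    proof (rule dependent_nat_choice)
      show "\<exists>\<phi>. P 0 \<phi>" unfolding P_def by (rule exI, rule point_combination_zero)
    next
      fix \<phi> k assume "P k \<phi>"
      then have \<phi>: "point_combination M \<phi>" by (simp add: P_def)
      obtain n where n: "4 ^ k < lip_norm M (f n)" using unb by blast
      then have pos: "0 < lip_norm M (f n)" by (rule less_trans[rotated]) simp
      obtain \<psi> where \<psi>: "point_combination M \<psi>" "\<And>h. h \<in> Lip_inf M \<Longrightarrow> \<bar>\<psi> h\<bar> \<le> lip_norm M h"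
          "3/4 * lip_norm M (f n) < \<bar>\<psi> (f n)\<bar>"
        using norming_point_combination[OF f[of n] False, of "3/4 * lip_norm M (f n)"] pos by auto
      obtain c :: real where c: "\<bar>c\<bar> = (1/3) ^ k" and "\<bar>c * \<psi> (f n)\<bar> \<le> \<bar>\<phi> (f n) + c * \<psi> (f n)\<bar>"
      proof -
        let ?b = "(1/3) ^ k * \<psi> (f n)"
        consider "\<bar>?b\<bar> \<le> \<bar>\<phi> (f n) + ?b\<bar>" | "\<bar>?b\<bar> \<le> \<bar>\<phi> (f n) - ?b\<bar>" by linarith
        then show thesis
          using that[of "(1/3) ^ k"] that[of "- ((1/3) ^ k)"] by cases auto
      qed
      moreover have "(1/3) ^ k * (3/4 * lip_norm M (f n)) \<le> \<bar>c * \<psi> (f n)\<bar>"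
        unfolding abs_mult c using \<psi>(3) by (intro mult_left_mono) auto
      ultimately have "(1/3) ^ k * (3/4 * lip_norm M (f n)) \<le> \<bar>\<phi> (f n) + c * \<psi> (f n)\<bar>" by linarith
      moreover have "\<bar>(\<phi> h + c * \<psi> h) - \<phi> h\<bar> \<le> (1/3) ^ k * lip_norm M h" if "h \<in> Lip_inf M" for h
        using mult_left_mono[OF \<psi>(2)[OF that], of "(1/3) ^ k"] by (simp add: abs_mult c)
      ultimately have "Q k \<phi> (\<lambda>h. \<phi> h + c * \<psi> h)"
        unfolding Q_def using less_imp_le[OF n] by blast
      moreover have "P (Suc k) (\<lambda>h. \<phi> h + c * \<psi> h)"
        unfolding P_def using \<phi> \<psi>(1) by (intro point_combination_add point_combination_scale)
      ultimately show "\<exists>\<phi>'. P (Suc k) \<phi>' \<and> Q k \<phi> \<phi>'" by blast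
    qed
    then obtain \<Phi> where \<Phi>: "\<And>k. P k (\<Phi> k)" "\<And>k. Q k (\<Phi> k) (\<Phi> (Suc k))" by blast
    define \<phi> where "\<phi> h = lim (\<lambda>k. \<Phi> k h)" for h
    have close: "\<bar>\<Phi> k h - \<phi> h\<bar> \<le> 3/2 * lip_norm M h * (1/3) ^ k" if "h \<in> Lip_inf M" for h k
    proof -
      have "\<bar>\<Phi> (Suc k) h - \<Phi> k h\<bar> \<le> lip_norm M h * (1/3) ^ k" for k
        using \<Phi>(2)[of k, unfolded Q_def] that by (simp add: mult.commute)
      from geometric_increments_tendsto[of "\<lambda>k. \<Phi> k h", OF this] obtain l where
        l: "(\<lambda>k. \<Phi> k h) \<longlonglongrightarrow> l" "\<And>k. \<bar>\<Phi> k h - l\<bar> \<le> 3/2 * lip_norm M h * (1/3) ^ k" by blast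
      have "\<phi> h = l" unfolding \<phi>_def by (rule limI[OF l(1)])
      then show ?thesis using l(2) by simp
    qed
    have "\<phi> \<in> lip_predual M"
    proof (rule lip_predual_if_approximable)
      fix \<epsilon> :: real assume "\<epsilon> > 0"
      then obtain k where k: "(1/3) ^ k < 2/3 * \<epsilon>"
        using real_arch_pow_inv[of "2/3 * \<epsilon>" "1/3"] by auto
      have "\<bar>\<phi> h - \<Phi> k h\<bar> \<le> \<epsilon> * lip_norm M h" if "h \<in> Lip_inf M" for h
      proof -
        have "3/2 * lip_norm M h * (1/3) ^ k \<le> 3/2 * lip_norm M h * (2/3 * \<epsilon>)"
          using k lip_norm_nonneg[OF that] by (intro mult_left_mono) auto
        with close[OF that, of k] show ?thesis by (simp add: abs_minus_commute mult.commute)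
      qed
      then show "\<exists>\<psi>. point_combination M \<psi> \<and> (\<forall>f\<in>Lip_inf M. \<bar>\<phi> f - \<psi> f\<bar> \<le> \<epsilon> * lip_norm M f)"
        using \<Phi>(1)[of k] unfolding P_def by blast
    qed
    then have "(\<lambda>n. \<phi> (f n)) \<longlonglongrightarrow> \<phi> g" using lim by (simp add: lip_weak_star_tendsto_def)
    then have "Bseq (\<lambda>n. \<phi> (f n))" by (intro convergent_imp_Bseq convergentI)
    then obtain B where B: "\<And>n. \<bar>\<phi> (f n)\<bar> \<le> B" by (auto simp: Bseq_def)
    obtain k where k: "4 * B < (4/3) ^ k" using real_arch_pow[of "4/3" "4 * B"] by auto
    obtain n where n: "4 ^ k \<le> lip_norm M (f n)"
        "(1/3) ^ k * (3/4 * lip_norm M (f n)) \<le> \<bar>\<Phi> (Suc k) (f n)\<bar>"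
      using \<Phi>(2)[of k] unfolding Q_def by blast
    have "\<bar>\<Phi> (Suc k) (f n) - \<phi> (f n)\<bar> \<le> (1/3) ^ k * (1/2 * lip_norm M (f n))"
      using close[OF f, of "Suc k" n] by (simp add: algebra_simps)
    then have "(1/3) ^ k * (1/4 * lip_norm M (f n)) \<le> \<bar>\<phi> (f n)\<bar>"
      using n(2) by linarith
    moreover have "(1/3) ^ k * (1/4 * 4 ^ k) \<le> (1/3) ^ k * (1/4 * lip_norm M (f n))"
      using n(1) by (intro mult_left_mono) auto
    moreover have "(1/3) ^ k * (1/4 * 4 ^ k) = 1/4 * (4/3 :: real) ^ k"
      by (simp add: power_divide)
    ultimately show False using B[of n] k by linarith
  qed
qed

lemma lip_weak_star_tendsto_bounded_pointwise:
  assumes f: "\<And>n. f n \<in> lip_ball M K" and g: "g \<in> lip_ball M K"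
    and lim: "\<And>x. x \<in> space M \<Longrightarrow> (\<lambda>n. f n x) \<longlonglongrightarrow> g x"
  shows "lip_weak_star_tendsto M f g"
  unfolding lip_weak_star_tendsto_def
proof (intro ballI LIMSEQ_I)
  fix \<phi> and r :: real assume \<phi>: "\<phi> \<in> lip_predual M" and r: "0 < r"
  obtain B where B: "0 \<le> B" "\<And>f. f \<in> lip_ball M K \<Longrightarrow> lip_norm M f \<le> B"
    using lip_norm_bounded_on_ball[of M K] by blast
  define \<epsilon> where "\<epsilon> = r / (3 * (B + 1))"
  have \<epsilon>: "\<epsilon> > 0" "\<epsilon> * B \<le> r / 3" 
    using r B(1) by (simp_all add: \<epsilon>_def field_simps)
  obtain F a where F: "finite F" "F \<subseteq> space M"
    and a: "\<And>f. f \<in> Lip_inf M \<Longrightarrow> \<bar>\<phi> f - (\<Sum>x\<in>F. a x * f x)\<bar> \<le> \<epsilon> * lip_norm M f"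
    using \<phi>[unfolded lip_predual_def, THEN CollectD, rule_format, OF \<epsilon>(1)] by blast
  have a': "\<bar>\<phi> h - (\<Sum>x\<in>F. a x * h x)\<bar> \<le> r / 3" if "h \<in> lip_ball M K" for h
  proof -
    have "\<epsilon> * lip_norm M h \<le> \<epsilon> * B" using B(2)[OF that] \<epsilon>(1) by (intro mult_left_mono) auto
    then show ?thesis using a[OF Lip_infI[OF that]] \<epsilon>(2) by linarith
  qed
  have "(\<lambda>n. \<Sum>x\<in>F. a x * f n x) \<longlonglongrightarrow> (\<Sum>x\<in>F. a x * g x)"
    using F lim by (intro tendsto_intros) auto
  from LIMSEQ_D[OF this, of "r / 3"] r obtain N where
    N: "\<And>n. n \<ge> N \<Longrightarrow> \<bar>(\<Sum>x\<in>F. a x * f n x) - (\<Sum>x\<in>F. a x * g x)\<bar> < r / 3" by auto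
  have "norm (\<phi> (f n) - \<phi> g) < r" if "n \<ge> N" for n
    unfolding real_norm_def using N[OF that] a'[OF f[of n]] a'[OF g] by linarith
  then show "\<exists>no. \<forall>n\<ge>no. norm (\<phi> (f n) - \<phi> g) < r" by blast
qed

section \<open>Derivations as operators on balls\<close>

text \<open>
  In this form a derivation can be restricted, extended and glued without referring to the norm or
  to the predual of the Lipschitz algebra. Weak* convergent sequences are bounded by the uniform
  boundedness principle and converge pointwise because point evaluations lie in the predual.
\<close>

lemma Der_iff:
  "D \<in> Der M \<longleftrightarrow>
     (\<forall>f\<in>Lip_inf M. D f \<in> L_inf M) \<and>
     (\<forall>f\<in>Lip_inf M. \<forall>g\<in>Lip_inf M. \<forall>a b.
        AE x in M. D (\<lambda>y. a * f y + b * g y) x = a * D f x + b * D g x) \<and>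
     (\<exists>C\<ge>0. \<forall>K. \<forall>f\<in>lip_ball M K. AE x in M. \<bar>D f x\<bar> \<le> C * K) \<and>
     (\<forall>f\<in>Lip_inf M. \<forall>g\<in>Lip_inf M.
        AE x in M. D (\<lambda>y. f y * g y) x = D f x * g x + f x * D g x) \<and>
     (\<forall>f g K. (\<forall>n. f n \<in> lip_ball M K) \<and> g \<in> lip_ball M K \<and>
        (\<forall>x\<in>space M. (\<lambda>n. f n x) \<longlonglongrightarrow> g x) \<longrightarrow> L_inf_weak_star_tendsto M (\<lambda>n. D (f n)) (D g))"
proof -
  have bd: "(\<exists>C. \<forall>f\<in>Lip_inf M. AE x in M. \<bar>D f x\<bar> \<le> C * lip_norm M f) \<longleftrightarrow>
    (\<exists>C\<ge>0. \<forall>K. \<forall>f\<in>lip_ball M K. AE x in M. \<bar>D f x\<bar> \<le> C * K)" (is "?L \<longleftrightarrow> ?R")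
  proof
    assume ?L
    then obtain C where C: "\<And>f. f \<in> Lip_inf M \<Longrightarrow> AE x in M. \<bar>D f x\<bar> \<le> C * lip_norm M f" by blast
    have "AE x in M. \<bar>D f x\<bar> \<le> \<bar>C\<bar> * K" if f: "f \<in> lip_ball M K" for f K
    proof (cases "space M = {}")
      case True
      then show ?thesis by (intro AE_I2) auto
    next
      case False
      have "C * lip_norm M f \<le> \<bar>C\<bar> * K"
        using lip_norm_le[OF f False] lip_norm_nonneg[OF Lip_infI[OF f]]
        by (intro mult_mono) auto
      then show ?thesis using C[OF Lip_infI[OF f]] by (auto elim!: eventually_mono)
    qed
    then show ?R by (intro exI[of _ "\<bar>C\<bar>"]) auto
  next
    assume ?R then show ?L using lip_ball_lip_norm by blast
  qed
  have wk: "(\<exists>K. (\<forall>n. f n \<in> lip_ball M K) \<and> g \<in> lip_ball M K) \<and>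
        (\<forall>x\<in>space M. (\<lambda>n. f n x) \<longlonglongrightarrow> g x)"
    if w: "\<forall>n. f n \<in> Lip_inf M" "g \<in> Lip_inf M" "lip_weak_star_tendsto M f g" for f g
  proof -
    obtain K where K: "\<And>n. lip_norm M (f n) \<le> K"
      using lip_weak_star_convergent_bounded[OF w(1)[rule_format] w(3)] by blast
    have "f n \<in> lip_ball M (max K (lip_norm M g))" for n
      using w(1) K[of n] by (intro lip_ball_mono[OF lip_ball_lip_norm]) auto
    moreover have "g \<in> lip_ball M (max K (lip_norm M g))"
      using w(2) by (intro lip_ball_mono[OF lip_ball_lip_norm]) auto
    moreover have "(\<lambda>n. f n x) \<longlonglongrightarrow> g x" if "x \<in> space M" for x
      using bspec[OF w(3)[unfolded lip_weak_star_tendsto_def] lip_predual_eval[OF that]] .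
    ultimately show ?thesis by blast
  qed
  have "(\<forall>f g. (\<forall>n. f n \<in> Lip_inf M) \<and> g \<in> Lip_inf M \<and> lip_weak_star_tendsto M f g \<longrightarrow>
        L_inf_weak_star_tendsto M (\<lambda>n. D (f n)) (D g)) \<longleftrightarrow>
     (\<forall>f g K. (\<forall>n. f n \<in> lip_ball M K) \<and> g \<in> lip_ball M K \<and>
        (\<forall>x\<in>space M. (\<lambda>n. f n x) \<longlonglongrightarrow> g x) \<longrightarrow> L_inf_weak_star_tendsto M (\<lambda>n. D (f n)) (D g))"
    (is "?L \<longleftrightarrow> ?R")
  proof
    assume L: ?L
    show ?R
    proof (intro allI impI)
      fix f g K
      assume *: "(\<forall>n. f n \<in> lip_ball M K) \<and> g \<in> lip_ball M K \<and>
        (\<forall>x\<in>space M. (\<lambda>n. f n x) \<longlonglongrightarrow> g x)"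
      then have "lip_weak_star_tendsto M f g"
        by (intro lip_weak_star_tendsto_bounded_pointwise[of f M K g]) auto
      then show "L_inf_weak_star_tendsto M (\<lambda>n. D (f n)) (D g)"
        using L[rule_format, of f g] * Lip_infI by blast
    qed
  next
    assume R: ?R
    show ?L
    proof (intro allI impI, elim conjE)
      fix f g
      assume *: "\<forall>n. f n \<in> Lip_inf M" "g \<in> Lip_inf M" "lip_weak_star_tendsto M f g"
      obtain K where "\<forall>n. f n \<in> lip_ball M K" "g \<in> lip_ball M K"
          "\<forall>x\<in>space M. (\<lambda>n. f n x) \<longlonglongrightarrow> g x"
        using wk[OF *] by blast
      then show "L_inf_weak_star_tendsto M (\<lambda>n. D (f n)) (D g)"
        by (intro R[rule_format, of f K g] conjI)
    qed
  qed
  then show ?thesis unfolding Der_def using bd by simp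
qed

lemma Der_L_inf: "D \<in> Der M \<Longrightarrow> f \<in> Lip_inf M \<Longrightarrow> D f \<in> L_inf M"
  by (simp add: Der_iff)

lemma Der_linear:
  "D \<in> Der M \<Longrightarrow> f \<in> Lip_inf M \<Longrightarrow> g \<in> Lip_inf M \<Longrightarrow>
    AE x in M. D (\<lambda>y. a * f y + b * g y) x = a * D f x + b * D g x"
  by (simp add: Der_iff)

lemma Der_product:
  "D \<in> Der M \<Longrightarrow> f \<in> Lip_inf M \<Longrightarrow> g \<in> Lip_inf M \<Longrightarrow>
    AE x in M. D (\<lambda>y. f y * g y) x = D f x * g x + f x * D g x"
  by (simp add: Der_iff)

lemma Der_bounded:
  "D \<in> Der M \<Longrightarrow> \<exists>C\<ge>0. \<forall>K. \<forall>f\<in>lip_ball M K. AE x in M. \<bar>D f x\<bar> \<le> C * K"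
  by (simp add: Der_iff)

lemma Der_weak_star:
  assumes "D \<in> Der M" "\<And>n. f n \<in> lip_ball M K" "g \<in> lip_ball M K"
    "\<And>x. x \<in> space M \<Longrightarrow> (\<lambda>n. f n x) \<longlonglongrightarrow> g x"
  shows "L_inf_weak_star_tendsto M (\<lambda>n. D (f n)) (D g)"
proof -
  have "\<forall>f g K. (\<forall>n. f n \<in> lip_ball M K) \<and> g \<in> lip_ball M K \<and>
      (\<forall>x\<in>space M. (\<lambda>n. f n x) \<longlonglongrightarrow> g x) \<longrightarrow> L_inf_weak_star_tendsto M (\<lambda>n. D (f n)) (D g)"
    using assms(1) by (simp add: Der_iff)
  from this[rule_format, of f K g] show ?thesis using assms(2-) by simp
qed

lemma DerI:
  assumes "\<And>f. f \<in> Lip_inf M \<Longrightarrow> D f \<in> L_inf M"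
    and "\<And>f g a b. f \<in> Lip_inf M \<Longrightarrow> g \<in> Lip_inf M \<Longrightarrow>
      AE x in M. D (\<lambda>y. a * f y + b * g y) x = a * D f x + b * D g x"
    and "0 \<le> C" "\<And>f K. f \<in> lip_ball M K \<Longrightarrow> AE x in M. \<bar>D f x\<bar> \<le> C * K"
    and "\<And>f g. f \<in> Lip_inf M \<Longrightarrow> g \<in> Lip_inf M \<Longrightarrow>
      AE x in M. D (\<lambda>y. f y * g y) x = D f x * g x + f x * D g x"
    and "\<And>f g K. (\<And>n. f n \<in> lip_ball M K) \<Longrightarrow> g \<in> lip_ball M K \<Longrightarrow>
      (\<And>x. x \<in> space M \<Longrightarrow> (\<lambda>n. f n x) \<longlonglongrightarrow> g x) \<Longrightarrow>
      L_inf_weak_star_tendsto M (\<lambda>n. D (f n)) (D g)"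
  shows "D \<in> Der M"
  unfolding Der_iff
proof (intro conjI ballI allI impI exI[of _ C] assms(1-5))
  fix f g K
  assume "(\<forall>n. f n \<in> lip_ball M K) \<and> g \<in> lip_ball M K \<and>
      (\<forall>x\<in>space M. (\<lambda>n. f n x) \<longlonglongrightarrow> g x)"
  then show "L_inf_weak_star_tendsto M (\<lambda>n. D (f n)) (D g)" by (intro assms(6)[of f K g]) auto
qed

text \<open>A function that vanishes on the space lies in the ball of radius \<open>0\<close>.\<close>

lemma Der_cong_space:
  assumes D: "D \<in> Der M" and f: "f \<in> Lip_inf M" and g: "g \<in> Lip_inf M"
    and eq: "\<And>x. x \<in> space M \<Longrightarrow> f x = g x"
  shows "AE x in M. D f x = D g x"
proof -
  obtain C where C: "0 \<le> C" "\<And>f K. f \<in> lip_ball M K \<Longrightarrow> AE x in M. \<bar>D f x\<bar> \<le> C * K"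
    using Der_bounded[OF D] by blast
  have "(\<lambda>x. 1 * f x + (-1) * g x) \<in> lip_ball M 0"
    using eq by (intro lip_ballI) auto
  from C(2)[OF this] Der_linear[OF D f g, of 1 "-1"] show ?thesis by eventually_elim simp
qed

subsection \<open>Multiplication by bounded functions\<close>

lemma L_infI: "u \<in> borel_measurable M \<Longrightarrow> AE x in M. \<bar>u x\<bar> \<le> C \<Longrightarrow> u \<in> L_inf M"
  by (auto simp: L_inf_def)

lemma L_inf_measurable [measurable_dest]: "u \<in> L_inf M \<Longrightarrow> u \<in> borel_measurable M"
  by (simp add: L_inf_def)

lemma L_inf_bounded:
  assumes "u \<in> L_inf M"
  obtains C where "0 \<le> C" "AE x in M. \<bar>u x\<bar> \<le> C"
proof -
  obtain C where "AE x in M. \<bar>u x\<bar> \<le> C" using assms by (auto simp: L_inf_def)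
  then have "AE x in M. \<bar>u x\<bar> \<le> \<bar>C\<bar>" by eventually_elim auto
  then show thesis using that[of "\<bar>C\<bar>"] by simp
qed

lemma L_inf_add:
  assumes "u \<in> L_inf M" "v \<in> L_inf M" shows "(\<lambda>x. u x + v x) \<in> L_inf M"
proof -
  obtain B where B: "AE x in M. \<bar>u x\<bar> \<le> B" using L_inf_bounded[OF assms(1)] .
  obtain C where C: "AE x in M. \<bar>v x\<bar> \<le> C" using L_inf_bounded[OF assms(2)] .
  from B C have "AE x in M. \<bar>u x + v x\<bar> \<le> B + C" by eventually_elim linarith
  then show ?thesis
    by (rule L_infI[OF borel_measurable_add[OF assms[THEN L_inf_measurable]]])
qed

lemma L_inf_mult:
  assumes "u \<in> L_inf M" "v \<in> L_inf M" shows "(\<lambda>x. u x * v x) \<in> L_inf M"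
proof -
  obtain B where B: "0 \<le> B" "AE x in M. \<bar>u x\<bar> \<le> B" using L_inf_bounded[OF assms(1)] .
  obtain C where C: "AE x in M. \<bar>v x\<bar> \<le> C" using L_inf_bounded[OF assms(2)] .
  from B(2) C have "AE x in M. \<bar>u x * v x\<bar> \<le> B * C"
    unfolding abs_mult by eventually_elim (use B(1) in \<open>intro mult_mono; simp\<close>)
  then show ?thesis
    by (rule L_infI[OF borel_measurable_times[OF assms[THEN L_inf_measurable]]])
qed

lemma L_inf_const: "(\<lambda>x. c) \<in> L_inf M"
  by (rule L_infI[of _ _ "\<bar>c\<bar>"]) simp_all

lemma L_inf_indicator: "A \<in> sets M \<Longrightarrow> indicator A \<in> L_inf M"
  by (rule L_infI[of _ _ 1]) (simp_all add: indicator_def[abs_def])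

lemma L_inf_uminus: "u \<in> L_inf M \<Longrightarrow> (\<lambda>x. - u x) \<in> L_inf M"
  using L_inf_mult[OF L_inf_const[of "-1"]] by simp

lemma integrable_L_inf_mult:
  assumes u: "u \<in> L_inf M" and h: "integrable M h"
  shows "integrable M (\<lambda>x. u x * h x)"
proof -
  obtain C where C: "0 \<le> C" "AE x in M. \<bar>u x\<bar> \<le> C" using L_inf_bounded[OF u] .
  show ?thesis
  proof (rule Bochner_Integration.integrable_bound[of M "\<lambda>x. C * h x"])
    show "integrable M (\<lambda>x. C * h x)" using h by simp
    show "(\<lambda>x. u x * h x) \<in> borel_measurable M" 
      using u h by (intro borel_measurable_times) (auto simp: L_inf_measurable)
    show "AE x in M. norm (u x * h x) \<le> norm (C * h x)"
      using C(2) by eventually_elim (use C(1) in \<open>auto simp: abs_mult intro!: mult_right_mono\<close>)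
  qed
qed

lemma Der_zero: "(\<lambda>f x. 0) \<in> Der M"
  by (rule DerI[where C = 0]) (auto simp: L_inf_const L_inf_weak_star_tendsto_def)

lemma Der_scale:
  assumes c: "c \<in> L_inf M" and D: "D \<in> Der M"
  shows "(\<lambda>f x. c x * D f x) \<in> Der M"
proof -
  obtain B where B: "0 \<le> B" "AE x in M. \<bar>c x\<bar> \<le> B" using L_inf_bounded[OF c] .
  obtain C where C: "0 \<le> C" "\<And>f K. f \<in> lip_ball M K \<Longrightarrow> AE x in M. \<bar>D f x\<bar> \<le> C * K"
    using Der_bounded[OF D] by blast
  show ?thesis
  proof (rule DerI[where C = "B * C"])
    fix f g :: "'a \<Rightarrow> real" and a b :: real assume fg: "f \<in> Lip_inf M" "g \<in> Lip_inf M"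
    show "AE x in M. c x * D (\<lambda>y. a * f y + b * g y) x = a * (c x * D f x) + b * (c x * D g x)"
      using Der_linear[OF D fg, of a b] by eventually_elim (simp add: algebra_simps)
    show "AE x in M. c x * D (\<lambda>y. f y * g y) x = c x * D f x * g x + f x * (c x * D g x)"
      using Der_product[OF D fg] by eventually_elim (simp add: algebra_simps)
  next
    fix f K assume f: "f \<in> lip_ball M K"
    show "AE x in M. \<bar>c x * D f x\<bar> \<le> B * C * K"
      using B(2) C(2)[OF f] unfolding abs_mult mult.assoc
      by eventually_elim (use B(1) in \<open>intro mult_mono; simp\<close>)
  next
    fix f :: "nat \<Rightarrow> 'a \<Rightarrow> real" and g K
    assume "\<And>n. f n \<in> lip_ball M K" "g \<in> lip_ball M K"
      "\<And>x. x \<in> space M \<Longrightarrow> (\<lambda>n. f n x) \<longlonglongrightarrow> g x"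
    from Der_weak_star[OF D this]
    have "(\<lambda>n. \<integral>x. D (f n) x * (c x * h x) \<partial>M) \<longlonglongrightarrow> (\<integral>x. D g x * (c x * h x) \<partial>M)"
      if "integrable M h" for h
      using integrable_L_inf_mult[OF c that] by (simp add: L_inf_weak_star_tendsto_def)
    then show "L_inf_weak_star_tendsto M (\<lambda>n x. c x * D (f n) x) (\<lambda>x. c x * D g x)"
      by (simp add: L_inf_weak_star_tendsto_def mult.left_commute mult.assoc)
  qed (use B(1) C(1) in \<open>simp_all add: L_inf_mult c Der_L_inf[OF D]\<close>)
qed

lemma Der_add:
  assumes D: "D \<in> Der M" and E: "E \<in> Der M"
  shows "(\<lambda>f x. D f x + E f x) \<in> Der M"
proof -
  obtain B where B: "0 \<le> B" "\<And>f K. f \<in> lip_ball M K \<Longrightarrow> AE x in M. \<bar>D f x\<bar> \<le> B * K"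
    using Der_bounded[OF D] by blast
  obtain C where C: "0 \<le> C" "\<And>f K. f \<in> lip_ball M K \<Longrightarrow> AE x in M. \<bar>E f x\<bar> \<le> C * K"
    using Der_bounded[OF E] by blast
  show ?thesis
  proof (rule DerI[where C = "B + C"])
    fix f g :: "'a \<Rightarrow> real" and a b :: real assume fg: "f \<in> Lip_inf M" "g \<in> Lip_inf M"
    show "AE x in M. D (\<lambda>y. a * f y + b * g y) x + E (\<lambda>y. a * f y + b * g y) x
        = a * (D f x + E f x) + b * (D g x + E g x)"
      using Der_linear[OF D fg, of a b] Der_linear[OF E fg, of a b] by eventually_elim (simp add: algebra_simps)
    show "AE x in M. D (\<lambda>y. f y * g y) x + E (\<lambda>y. f y * g y) x
        = (D f x + E f x) * g x + f x * (D g x + E g x)"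
      using Der_product[OF D fg] Der_product[OF E fg] by eventually_elim (simp add: algebra_simps)
  next
    fix f K assume f: "f \<in> lip_ball M K"
    show "AE x in M. \<bar>D f x + E f x\<bar> \<le> (B + C) * K"
      using B(2)[OF f] C(2)[OF f] unfolding distrib_right by eventually_elim linarith
  next
    fix f :: "nat \<Rightarrow> 'a \<Rightarrow> real" and g K
    assume f: "\<And>n. f n \<in> lip_ball M K" and g: "g \<in> lip_ball M K"
      and lim: "\<And>x. x \<in> space M \<Longrightarrow> (\<lambda>n. f n x) \<longlonglongrightarrow> g x"
    show "L_inf_weak_star_tendsto M (\<lambda>n x. D (f n) x + E (f n) x) (\<lambda>x. D g x + E g x)"
      unfolding L_inf_weak_star_tendsto_def
    proof (intro allI impI)
      fix h :: "'a \<Rightarrow> real" assume h: "integrable M h"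
      have "(\<lambda>n. (\<integral>x. D (f n) x * h x \<partial>M) + (\<integral>x. E (f n) x * h x \<partial>M))
          \<longlonglongrightarrow> (\<integral>x. D g x * h x \<partial>M) + (\<integral>x. E g x * h x \<partial>M)"
        using Der_weak_star[OF D f g lim] Der_weak_star[OF E f g lim] h
        by (intro tendsto_add) (auto simp: L_inf_weak_star_tendsto_def)
      moreover have eq: "(\<integral>x. (D k x + E k x) * h x \<partial>M) = (\<integral>x. D k x * h x \<partial>M) + (\<integral>x. E k x * h x \<partial>M)"
        if "k \<in> lip_ball M K" for k
        unfolding distrib_right
        using integrable_L_inf_mult[OF Der_L_inf[OF D Lip_infI[OF that]] h]
          integrable_L_inf_mult[OF Der_L_inf[OF E Lip_infI[OF that]] h]
        by (rule Bochner_Integration.integral_add)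
      ultimately show "(\<lambda>n. \<integral>x. (D (f n) x + E (f n) x) * h x \<partial>M) \<longlonglongrightarrow> (\<integral>x. (D g x + E g x) * h x \<partial>M)"
        by (simp only: eq[OF f] eq[OF g])
    qed
  qed (use B(1) C(1) in \<open>simp_all add: L_inf_add Der_L_inf[OF D] Der_L_inf[OF E]\<close>)
qed

lemma Der_lincomb:
  assumes "\<And>i. i < n \<Longrightarrow> c i \<in> L_inf M" "\<And>i. i < n \<Longrightarrow> D i \<in> Der M"
  shows "der_lincomb n c D \<in> Der M"
  using assms
proof (induction n)
  case 0
  then show ?case by (simp add: der_lincomb_def Der_zero)
next
  case (Suc n)
  have "der_lincomb n c D \<in> Der M" by (rule Suc.IH) (simp_all add: Suc.prems)
  from Der_add[OF this Der_scale[OF Suc.prems(1)[of n] Suc.prems(2)[of n]]]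
  show ?case by (simp add: der_lincomb_def)
qed

section \<open>Locality\<close>

text \<open>Test with \<open>sgn u\<close> times a strictly positive integrable function.\<close>

lemma AE_zero_if_integrals_zero:
  assumes "sigma_finite_measure M" and u: "u \<in> L_inf M"
    and zero: "\<And>h. integrable M h \<Longrightarrow> (\<integral>x. u x * h x \<partial>M) = 0"
  shows "AE x in M. u x = 0"
proof -
  obtain w :: "'a \<Rightarrow> real" where w: "w \<in> borel_measurable M" "\<And>x. 0 < w x" "\<And>x. w x \<le> 1" "integrable M w"
    by (rule sigma_finite_measure.obtain_positive_integrable_function[OF assms(1)], rule that)
  have [measurable]: "u \<in> borel_measurable M" by (rule L_inf_measurable[OF u])
  have "(\<lambda>x. sgn (u x)) \<in> L_inf M"
    by (rule L_infI[of _ _ 1]) (simp_all add: sgn_if)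
  then have h: "integrable M (\<lambda>x. sgn (u x) * w x)" using w(4) by (rule integrable_L_inf_mult)
  have eq: "u x * (sgn (u x) * w x) = \<bar>u x\<bar> * w x" for x by (simp add: abs_sgn mult.assoc)
  have int: "integrable M (\<lambda>x. \<bar>u x\<bar> * w x)" "(\<integral>x. \<bar>u x\<bar> * w x \<partial>M) = 0"
    using integrable_L_inf_mult[OF u h] zero[OF h] by (simp_all only: eq)
  have nn: "AE x in M. 0 \<le> \<bar>u x\<bar> * w x"
    by (rule AE_I2) (intro mult_nonneg_nonneg abs_ge_zero less_imp_le[OF w(2)])
  from integral_nonneg_eq_0_iff_AE[OF int(1) nn] int(2)
  have "AE x in M. \<bar>u x\<bar> * w x = 0" by blast
  then show ?thesis
  proof eventually_elim
    case (elim x)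
    then show ?case using w(2)[of x] by simp
  qed
qed

lemma abs_clip_diff_le:
  fixes e s t :: real
  shows "\<bar>max (- e) (min e s) - max (- e) (min e t)\<bar> \<le> \<bar>s - t\<bar>"
proof -
  have max_diff: "\<bar>max a b - max a c\<bar> \<le> \<bar>b - c\<bar>" for a b c :: real
    by (simp add: max_def)
  have "\<bar>max (- e) (min e s) - max (- e) (min e t)\<bar> \<le> \<bar>min e s - min e t\<bar>"
    using max_diff[of "- e" "min e s" "min e t"] .
  also have "\<dots> \<le> \<bar>s - t\<bar>" by (simp add: min_def)
  finally show ?thesis .
qed

text \<open>
  A Lipschitz function \<open>f\<close> vanishing on \<open>U\<close> is the weak* limit, as \<open>\<epsilon> \<rightarrow> 0\<close>, of the functions \<open>\<psi>\<close>
  obtained by moving its values by up to \<open>\<epsilon>\<close> towards \<open>0\<close>. As \<open>\<psi> = 0\<close> where \<open>\<bar>f\<bar> \<le> \<epsilon>\<close>, these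
  satisfy \<open>\<psi> = \<psi> \<eta>\<close> for the Lipschitz function \<open>\<eta> = min 1 (\<bar>f\<bar> / \<epsilon>)\<close>, which also vanishes
  on \<open>U\<close>; so by the Leibniz rule their derivatives vanish there.
\<close>

lemma Der_zero_on:
  assumes M: "sigma_finite_measure M" and D: "D \<in> Der M" and U: "U \<in> sets M"
    and f: "f \<in> Lip_inf M" and zero: "\<And>x. x \<in> U \<Longrightarrow> f x = 0"
  shows "AE x in M. x \<in> U \<longrightarrow> D f x = 0"
proof -
  obtain K where K: "f \<in> lip_ball M K" using f by (auto simp: Lip_inf_iff)
  define \<tau> where "\<tau> n x = max (- (1 / real (Suc n))) (min (1 / real (Suc n)) (f x))" for n x
  define \<psi> where "\<psi> n x = f x - \<tau> n x" for n x
  define \<eta> where "\<eta> n x = min 1 (real (Suc n) * \<bar>f x\<bar>)" for n x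
  have \<tau>: "\<bar>\<tau> n x - \<tau> n y\<bar> \<le> \<bar>f x - f y\<bar>" "\<bar>\<tau> n x\<bar> \<le> \<bar>f x\<bar>" for n x y
    using abs_clip_diff_le[of "1 / real (Suc n)" "f x" "f y"]
      abs_clip_diff_le[of "1 / real (Suc n)" "f x" 0] by (simp_all add: \<tau>_def)
  have \<psi>: "\<psi> n \<in> lip_ball M (2 * K)" for n
  proof (rule lip_ballI)
    show "0 \<le> 2 * K" using lip_ballD(1)[OF K] by simp
    fix x assume "x \<in> space M"
    then have "\<bar>f x\<bar> \<le> K" using lip_ballD[OF K] by blast
    then show "\<bar>\<psi> n x\<bar> \<le> 2 * K" using \<tau>(2)[of n x] unfolding \<psi>_def by linarith
  next
    fix x y assume "x \<in> space M" "y \<in> space M"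
    then have "\<bar>f x - f y\<bar> \<le> K * dist x y" using lip_ballD[OF K] by blast
    then show "\<bar>\<psi> n x - \<psi> n y\<bar> \<le> 2 * K * dist x y"
      using \<tau>(1)[of n x y] unfolding \<psi>_def by linarith
  qed
  have \<eta>: "\<eta> n \<in> lip_ball M (1 + real (Suc n) * K)" for n
  proof (rule lip_ballI)
    have "0 \<le> real (Suc n) * K" using lip_ballD(1)[OF K] by (intro mult_nonneg_nonneg) auto
    then show "0 \<le> 1 + real (Suc n) * K" by linarith
    fix x
    have "0 \<le> real (Suc n) * \<bar>f x\<bar>" by simp
    then show "\<bar>\<eta> n x\<bar> \<le> 1 + real (Suc n) * K"
      using \<open>0 \<le> real (Suc n) * K\<close> unfolding \<eta>_def by linarith
  next
    fix x y assume xy: "x \<in> space M" "y \<in> space M"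
    have "\<bar>\<eta> n x - \<eta> n y\<bar> \<le> \<bar>real (Suc n) * \<bar>f x\<bar> - real (Suc n) * \<bar>f y\<bar>\<bar>"
      unfolding \<eta>_def by linarith
    also have "\<dots> = real (Suc n) * \<bar>\<bar>f x\<bar> - \<bar>f y\<bar>\<bar>"
      by (simp only: right_diff_distrib[symmetric] abs_mult)
    also have "\<dots> \<le> real (Suc n) * (K * dist x y)"
      using lip_ballD(3)[OF K xy] by (intro mult_left_mono) auto
    finally show "\<bar>\<eta> n x - \<eta> n y\<bar> \<le> (1 + real (Suc n) * K) * dist x y"
      using zero_le_dist[of x y] by (simp only: distrib_right mult.assoc)
  qed
  have prod: "(\<lambda>y. \<psi> n y * \<eta> n y) = \<psi> n" for n
  proof
    fix y
    show "\<psi> n y * \<eta> n y = \<psi> n y"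
    proof (cases "real (Suc n) * \<bar>f y\<bar> \<le> 1")
      case True
      then have "\<bar>f y\<bar> \<le> 1 / real (Suc n)" by (simp add: field_simps)
      then have "\<psi> n y = 0" by (simp add: \<psi>_def \<tau>_def abs_le_iff max_def min_def)
      then show ?thesis by simp
    qed (simp add: \<eta>_def)
  qed
  let ?E = "\<lambda>f x. indicator U x * D f x"
  have E: "?E \<in> Der M" by (rule Der_scale[OF L_inf_indicator[OF U] D])
  have E\<psi>: "AE x in M. ?E (\<psi> n) x = 0" for n
    using Der_product[OF D Lip_infI[OF \<psi>] Lip_infI[OF \<eta>], of n n, unfolded prod]
  proof eventually_elim
    case (elim x)
    have "\<psi> n x = 0 \<and> \<eta> n x = 0" if "x \<in> U"
      using zero[OF that] by (simp add: \<psi>_def \<tau>_def \<eta>_def)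
    with elim show ?case by (auto simp: indicator_def)
  qed
  have lim: "(\<lambda>n. \<psi> n x) \<longlonglongrightarrow> f x" for x
  proof -
    have "(\<lambda>n. max (- (1 / real (Suc n))) (min (1 / real (Suc n)) (f x))) \<longlonglongrightarrow> max (- 0) (min 0 (f x))"
      by (intro tendsto_max tendsto_min tendsto_minus tendsto_const LIMSEQ_Suc[OF lim_1_over_n])
    from tendsto_diff[OF tendsto_const[of "f x"] this] show ?thesis by (simp add: \<psi>_def \<tau>_def)
  qed
  have wk: "L_inf_weak_star_tendsto M (\<lambda>n. ?E (\<psi> n)) (?E f)"
    by (rule Der_weak_star[OF E \<psi> lip_ball_mono[OF K] lim]) (use lip_ballD(1)[OF K] in auto)
  have "AE x in M. ?E f x = 0"
  proof (rule AE_zero_if_integrals_zero[OF M Der_L_inf[OF E f]])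
    fix h :: "'a \<Rightarrow> real" assume h: "integrable M h"
    have eq: "(\<integral>x. ?E (\<psi> n) x * h x \<partial>M) = 0" for n
      by (rule integral_eq_zero_AE) (use E\<psi>[of n] in eventually_elim, auto)
    show "(\<integral>x. ?E f x * h x \<partial>M) = 0"
      using wk[unfolded L_inf_weak_star_tendsto_def, rule_format, OF h]
      unfolding eq by (rule LIMSEQ_unique) simp
  qed
  then show ?thesis by eventually_elim (auto simp: indicator_def)
qed

lemma Der_local:
  assumes M: "sigma_finite_measure M" and D: "D \<in> Der M" and U: "U \<in> sets M"
    and f: "f \<in> Lip_inf M" and g: "g \<in> Lip_inf M" and eq: "\<And>x. x \<in> U \<Longrightarrow> f x = g x"
  shows "AE x in M. x \<in> U \<longrightarrow> D f x = D g x"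
proof -
  have "AE x in M. x \<in> U \<longrightarrow> D (\<lambda>y. 1 * f y + (-1) * g y) x = 0"
    using eq by (intro Der_zero_on[OF M D U Lip_inf_lincomb[OF f g]]) auto
  with Der_linear[OF D f g, of 1 "-1"] show ?thesis by eventually_elim auto
qed

section \<open>Restriction and extension of derivations\<close>

lemma AE_restrict: "U \<in> sets M \<Longrightarrow> (AE x in restrict_space M U. P x) \<longleftrightarrow> (AE x in M. x \<in> U \<longrightarrow> P x)"
  by (simp add: AE_restrict_space_iff)

lemma lip_ball_restrict: "U \<in> sets M \<Longrightarrow> f \<in> lip_ball M K \<Longrightarrow> f \<in> lip_ball (restrict_space M U) K"
  using sets.sets_into_space[of U M] lip_ballD[of f M K] by (intro lip_ballI) (simp_all add: subset_iff)

lemma Lip_inf_restrict: "U \<in> sets M \<Longrightarrow> f \<in> Lip_inf M \<Longrightarrow> f \<in> Lip_inf (restrict_space M U)"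
  unfolding Lip_inf_iff using lip_ball_restrict by blast

lemma L_inf_restrict_iff:
  assumes U: "U \<in> sets M"
  shows "u \<in> L_inf (restrict_space M U) \<longleftrightarrow> (\<lambda>x. indicator U x * u x) \<in> L_inf M"
proof -
  have "(\<exists>C. AE x in M. x \<in> U \<longrightarrow> \<bar>u x\<bar> \<le> C) \<longleftrightarrow> (\<exists>C. AE x in M. \<bar>indicator U x * u x\<bar> \<le> C)"
  proof (intro iffI; elim exE)
    fix C assume "AE x in M. x \<in> U \<longrightarrow> \<bar>u x\<bar> \<le> C"
    then have "AE x in M. \<bar>indicator U x * u x\<bar> \<le> \<bar>C\<bar>"
      by eventually_elim (auto simp: indicator_def)
    then show "\<exists>C. AE x in M. \<bar>indicator U x * u x\<bar> \<le> C" by blast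
  next
    fix C assume "AE x in M. \<bar>indicator U x * u x\<bar> \<le> C"
    then have "AE x in M. x \<in> U \<longrightarrow> \<bar>u x\<bar> \<le> C"
      by eventually_elim (auto simp: indicator_def)
    then show "\<exists>C. AE x in M. x \<in> U \<longrightarrow> \<bar>u x\<bar> \<le> C" by blast
  qed
  then show ?thesis
    using U by (simp add: L_inf_def AE_restrict borel_measurable_restrict_space_iff)
qed

lemma L_inf_restrict:
  "U \<in> sets M \<Longrightarrow> u \<in> L_inf M \<Longrightarrow> u \<in> L_inf (restrict_space M U)"
  by (simp add: L_inf_restrict_iff L_inf_mult L_inf_indicator)

lemma integrable_restrict_iff:
  fixes h :: "'a \<Rightarrow> real"
  shows "U \<in> sets M \<Longrightarrow> integrable (restrict_space M U) h \<longleftrightarrow> integrable M (\<lambda>x. indicator U x * h x)"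
  by (simp add: integrable_restrict_space)

lemma integral_restrict:
  fixes h :: "'a \<Rightarrow> real"
  shows "U \<in> sets M \<Longrightarrow> integral\<^sup>L (restrict_space M U) h = (\<integral>x. indicator U x * h x \<partial>M)"
  by (simp add: integral_restrict_space)

lemma Der_extend_zero:
  assumes U: "U \<in> sets M" and D: "D \<in> Der (restrict_space M U)"
  shows "(\<lambda>f x. indicator U x * D f x) \<in> Der M"
proof -
  obtain C where C: "0 \<le> C"
    "\<And>f K. f \<in> lip_ball (restrict_space M U) K \<Longrightarrow> AE x in restrict_space M U. \<bar>D f x\<bar> \<le> C * K"
    using Der_bounded[OF D] by blast
  show ?thesis
  proof (rule DerI[OF _ _ C(1)])
    fix f assume "f \<in> Lip_inf M"
    from Der_L_inf[OF D Lip_inf_restrict[OF U this]]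
    show "(\<lambda>x. indicator U x * D f x) \<in> L_inf M" by (simp add: L_inf_restrict_iff[OF U])
  next
    fix f g a b assume "f \<in> Lip_inf M" "g \<in> Lip_inf M"
    note fg = this[THEN Lip_inf_restrict[OF U]]
    show "AE x in M. indicator U x * D (\<lambda>y. a * f y + b * g y) x
        = a * (indicator U x * D f x) + b * (indicator U x * D g x)"
      using Der_linear[OF D fg, of a b] unfolding AE_restrict[OF U]
      by eventually_elim (auto simp: indicator_def)
  next
    fix f g assume "f \<in> Lip_inf M" "g \<in> Lip_inf M"
    note fg = this[THEN Lip_inf_restrict[OF U]]
    show "AE x in M. indicator U x * D (\<lambda>y. f y * g y) x
        = indicator U x * D f x * g x + f x * (indicator U x * D g x)"
      using Der_product[OF D fg] unfolding AE_restrict[OF U]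
      by eventually_elim (auto simp: indicator_def)
  next
    fix f K assume f: "f \<in> lip_ball M K"
    have "0 \<le> C * K" using C(1) lip_ballD(1)[OF f] by simp
    with C(2)[OF lip_ball_restrict[OF U f]]
    show "AE x in M. \<bar>indicator U x * D f x\<bar> \<le> C * K" unfolding AE_restrict[OF U]
      by (auto simp: indicator_def elim: eventually_mono)
  next
    fix f :: "nat \<Rightarrow> 'a \<Rightarrow> real" and g K
    assume f: "\<And>n. f n \<in> lip_ball M K" and g: "g \<in> lip_ball M K"
      and lim: "\<And>x. x \<in> space M \<Longrightarrow> (\<lambda>n. f n x) \<longlonglongrightarrow> g x"
    have wk: "L_inf_weak_star_tendsto (restrict_space M U) (\<lambda>n. D (f n)) (D g)"
      using sets.sets_into_space[OF U] U
      by (intro Der_weak_star[OF D lip_ball_restrict[OF U f] lip_ball_restrict[OF U g]] lim) auto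
    show "L_inf_weak_star_tendsto M (\<lambda>n x. indicator U x * D (f n) x) (\<lambda>x. indicator U x * D g x)"
      unfolding L_inf_weak_star_tendsto_def
    proof (intro allI impI)
      fix h :: "'a \<Rightarrow> real" assume "integrable M h"
      then have "integrable (restrict_space M U) h"
        by (simp add: integrable_restrict_iff[OF U] integrable_L_inf_mult L_inf_indicator U)
      then show "(\<lambda>n. \<integral>x. indicator U x * D (f n) x * h x \<partial>M)
          \<longlonglongrightarrow> (\<integral>x. indicator U x * D g x * h x \<partial>M)"
        using wk by (simp add: L_inf_weak_star_tendsto_def integral_restrict[OF U] mult.assoc)
    qed
  qed
qed

text \<open>McShane's extension, truncated to keep the bound.\<close>

lemma lip_ball_extend:
  assumes U: "U \<in> sets M" and f: "f \<in> lip_ball (restrict_space M U) K"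
  obtains F where "F \<in> lip_ball M K" "\<And>x. x \<in> U \<Longrightarrow> F x = f x"
proof (cases "U = {}")
  case True
  have "(\<lambda>_. 0) \<in> lip_ball M K" using lip_ballD(1)[OF f] by (intro lip_ballI) auto
  then show thesis using that True by blast
next
  case False
  have f': "0 \<le> K" "\<And>x. x \<in> U \<Longrightarrow> \<bar>f x\<bar> \<le> K"
      "\<And>x y. x \<in> U \<Longrightarrow> y \<in> U \<Longrightarrow> \<bar>f x - f y\<bar> \<le> K * dist x y"
    using lip_ballD[OF f] U by auto
  define G where "G x = (INF y\<in>U. f y + K * dist x y)" for x
  have bdd: "bdd_below ((\<lambda>y. f y + K * dist x y) ` U)" for x
  proof (intro bdd_belowI2)
    fix y assume "y \<in> U"
    then show "- K \<le> f y + K * dist x y"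
      using f'(2)[of y] mult_nonneg_nonneg[OF f'(1) zero_le_dist[of x y]] by linarith
  qed
  have upper: "G x \<le> f y + K * dist x y" if "y \<in> U" for x y
    unfolding G_def by (rule cINF_lower[OF bdd that])
  have lower: "c \<le> G x" if "\<And>y. y \<in> U \<Longrightarrow> c \<le> f y + K * dist x y" for c x
    unfolding G_def by (rule cINF_greatest[OF False that])
  have G_eq: "G x = f x" if "x \<in> U" for x
  proof (rule antisym)
    show "G x \<le> f x" using upper[OF that, of x] by simp
    show "f x \<le> G x"
    proof (rule lower)
      fix y assume "y \<in> U"
      from f'(3)[OF that this] show "f x \<le> f y + K * dist x y" by linarith
    qed
  qed
  have G_le: "G x - K * dist x z \<le> G z" for x z
  proof (rule lower)
    fix y assume "y \<in> U"
    have "K * dist x y \<le> K * (dist x z + dist z y)"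
      using f'(1) dist_triangle[of x y z] by (intro mult_left_mono)
    with upper[OF \<open>y \<in> U\<close>, of x] show "G x - K * dist x z \<le> f y + K * dist z y"
      by (simp add: distrib_left)
  qed
  show thesis
  proof
    show "(\<lambda>x. max (- K) (min K (G x))) \<in> lip_ball M K"
    proof (rule lip_ballI[OF f'(1)])
      show "\<bar>max (- K) (min K (G x))\<bar> \<le> K" for x using f'(1) by (simp add: max_def min_def abs_le_iff)
      fix x y
      show "\<bar>max (- K) (min K (G x)) - max (- K) (min K (G y))\<bar> \<le> K * dist x y"
        using abs_clip_diff_le[of K "G x" "G y"] G_le[of x y] G_le[of y x]
        unfolding dist_commute[of y x] by linarith
    qed
    fix x assume "x \<in> U"
    then show "max (- K) (min K (G x)) = f x"
      using G_eq[of x] f'(2)[of x] by (simp add: abs_le_iff max_def min_def)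
  qed
qed

definition lip_extension :: "'a::metric_space measure \<Rightarrow> 'a set \<Rightarrow> ('a \<Rightarrow> real) \<Rightarrow> 'a \<Rightarrow> real" where
  "lip_extension M U f = (SOME F. F \<in> Lip_inf M \<and> (\<forall>x\<in>U. F x = f x))"

lemma lip_extension:
  assumes U: "U \<in> sets M" and f: "f \<in> Lip_inf (restrict_space M U)"
  shows "lip_extension M U f \<in> Lip_inf M" "\<And>x. x \<in> U \<Longrightarrow> lip_extension M U f x = f x"
proof -
  obtain K where "f \<in> lip_ball (restrict_space M U) K" using f by (auto simp: Lip_inf_iff)
  then obtain F where "F \<in> lip_ball M K" "\<And>x. x \<in> U \<Longrightarrow> F x = f x"
    using lip_ball_extend[OF U] by blast
  then have "\<exists>F. F \<in> Lip_inf M \<and> (\<forall>x\<in>U. F x = f x)" using Lip_infI by blast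
  from someI_ex[OF this]
  show "lip_extension M U f \<in> Lip_inf M" "\<And>x. x \<in> U \<Longrightarrow> lip_extension M U f x = f x"
    unfolding lip_extension_def by blast+
qed

lemma metric_measure_space_dense:
  fixes M :: "'a::metric_space measure"
  assumes "metric_measure_space M"
  obtains C where "countable C" "C \<subseteq> space M"
    "\<And>x e. x \<in> space M \<Longrightarrow> 0 < e \<Longrightarrow> \<exists>y\<in>C. dist x y < e"
proof -
  obtain C where C: "countable C" "C \<subseteq> space M" "top_of_set (space M) closure_of C = space M"
    using assms by (auto simp: metric_measure_space_def separable_space_def)
  have "\<exists>y\<in>C. dist x y < e" if "x \<in> space M" "0 < e" for x e
  proof -
    have x: "x \<in> top_of_set (space M) closure_of C" using C(3) that(1) by simp
    have "openin (top_of_set (space M)) (space M \<inter> ball x e)" by (intro openin_open_Int) simp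
    then have "\<exists>y. y \<in> C \<and> y \<in> space M \<inter> ball x e"
      using x[unfolded in_closure_of, THEN conjunct2, rule_format, of "space M \<inter> ball x e"] that
      by simp
    then show ?thesis by auto
  qed
  with C(1,2) show thesis using that by blast
qed

text \<open>
  Balls of the Lipschitz algebra are sequentially compact for pointwise convergence: a diagonal
  sequence converges on a countable dense set, hence everywhere by equicontinuity.
\<close>

lemma lip_ball_seq_compact:
  fixes M :: "'a::metric_space measure"
  assumes M: "metric_measure_space M" and F: "\<And>n. F n \<in> lip_ball M K"
  obtains s G where "strict_mono (s :: nat \<Rightarrow> nat)" "G \<in> lip_ball M K"
    "\<And>x. x \<in> space M \<Longrightarrow> (\<lambda>n. F (s n) x) \<longlonglongrightarrow> G x"
proof -
  obtain C where C: "countable C" "C \<subseteq> space M"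
    "\<And>x e. x \<in> space M \<Longrightarrow> 0 < e \<Longrightarrow> \<exists>y\<in>C. dist x y < e"
    using metric_measure_space_dense[OF M] by blast
  have "norm (F n x) \<le> K" if "x \<in> C" for n x
    using lip_ballD(2)[OF F] that C(2) by auto
  then obtain s where s: "strict_mono (s::nat \<Rightarrow> nat)"
    "\<And>x. x \<in> C \<Longrightarrow> \<exists>l. (\<lambda>n. F (s n) x) \<longlonglongrightarrow> l"
    using function_convergent_subsequence[OF C(1), of F K] by blast
  have K: "0 \<le> K" using lip_ballD(1)[OF F] .
  have conv: "\<exists>l. (\<lambda>n. F (s n) x) \<longlonglongrightarrow> l" if x: "x \<in> space M" for x
  proof -
    have "Cauchy (\<lambda>n. F (s n) x)"
    proof (rule metric_CauchyI)
      fix e :: real assume e: "0 < e"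
      have pos: "0 < e / (3 * (K + 1))" using e K by simp
      obtain y where y: "y \<in> C" "dist x y < e / (3 * (K + 1))" using C(3)[OF x pos] by blast
      have close: "\<bar>F n x - F n y\<bar> \<le> e / 3" for n
      proof -
        have "\<bar>F n x - F n y\<bar> \<le> K * dist x y" using lip_ballD(3)[OF F x] y(1) C(2) by blast
        also have "\<dots> \<le> (K + 1) * (e / (3 * (K + 1)))" using y(2) K by (intro mult_mono) auto
        also have "\<dots> = e / 3" using K by (simp add: field_simps)
        finally show ?thesis .
      qed
      have "Cauchy (\<lambda>n. F (s n) y)" using s(2)[OF y(1)] LIMSEQ_imp_Cauchy by blast
      then obtain N where N: "\<And>m n. m \<ge> N \<Longrightarrow> n \<ge> N \<Longrightarrow> \<bar>F (s m) y - F (s n) y\<bar> < e / 3"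
        using metric_CauchyD[of "\<lambda>n. F (s n) y" "e / 3"] e unfolding dist_real_def by auto
      have "dist (F (s m) x) (F (s n) x) < e" if "m \<ge> N" "n \<ge> N" for m n
        using N[OF that] close[of "s m"] close[of "s n"] unfolding dist_real_def by linarith
      then show "\<exists>N. \<forall>m\<ge>N. \<forall>n\<ge>N. dist (F (s m) x) (F (s n) x) < e" by blast
    qed
    then show ?thesis by (simp add: Cauchy_convergent_iff convergent_def)
  qed
  define G where "G x = lim (\<lambda>n. F (s n) x)" for x
  have G: "(\<lambda>n. F (s n) x) \<longlonglongrightarrow> G x" if "x \<in> space M" for x
    using conv[OF that] unfolding G_def by (simp add: convergent_LIMSEQ_iff[symmetric] convergent_def)
  have "G \<in> lip_ball M K"
  proof (rule lip_ballI[OF K])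
    fix x assume x: "x \<in> space M"
    show "\<bar>G x\<bar> \<le> K"
      by (rule LIMSEQ_le_const2[OF tendsto_rabs[OF G[OF x]]]) (use lip_ballD(2)[OF F x] in auto)
    fix y assume y: "y \<in> space M"
    show "\<bar>G x - G y\<bar> \<le> K * dist x y"
      by (rule LIMSEQ_le_const2[OF tendsto_rabs[OF tendsto_diff[OF G[OF x] G[OF y]]]])
        (use lip_ballD(3)[OF F x y] in auto)
  qed
  with s(1) G show thesis using that by blast
qed

text \<open>
  By locality, \<open>D F\<close> on \<open>U\<close> depends only on the values of \<open>F\<close> on \<open>U\<close>, so \<open>D\<close> can be applied to
  functions on \<open>U\<close> through any extension. Extensions of a convergent sequence need not converge
  outside \<open>U\<close>, but every subsequence has a convergent subsequence, whose limit
  extends the given limit; this is enough for weak* continuity.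
\<close>

lemma Der_restrict:
  fixes M :: "'a::metric_space measure"
  assumes M: "metric_measure_space M" "sigma_finite_measure M" and U: "U \<in> sets M" and D: "D \<in> Der M"
  shows "\<exists>E \<in> Der (restrict_space M U).
    \<forall>f\<in>Lip_inf (restrict_space M U). \<forall>F\<in>Lip_inf M. (\<forall>x\<in>U. F x = f x) \<longrightarrow>
      (AE x in restrict_space M U. E f x = D F x)"
proof -
  let ?R = "restrict_space M U"
  define E where "E f = D (lip_extension M U f)" for f
  have E: "AE x in ?R. E f x = D F x"
    if f: "f \<in> Lip_inf ?R" and F: "F \<in> Lip_inf M" "\<And>x. x \<in> U \<Longrightarrow> F x = f x" for f F
    unfolding E_def AE_restrict[OF U]
    by (rule Der_local[OF M(2) D U]) (use lip_extension[OF U f] F in auto)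
  obtain C where C: "0 \<le> C" "\<And>f K. f \<in> lip_ball M K \<Longrightarrow> AE x in M. \<bar>D f x\<bar> \<le> C * K"
    using Der_bounded[OF D] by blast
  have AE_R: "AE x in ?R. P x" if "AE x in M. P x" for P
    using that unfolding AE_restrict[OF U] by eventually_elim simp
  have "E \<in> Der ?R"
  proof (rule DerI[OF _ _ C(1)])
    fix f assume f: "f \<in> Lip_inf ?R"
    show "E f \<in> L_inf ?R"
      unfolding E_def by (intro L_inf_restrict[OF U] Der_L_inf[OF D] lip_extension[OF U f])
  next
    fix f g a b assume f: "f \<in> Lip_inf ?R" and g: "g \<in> Lip_inf ?R"
    note F = lip_extension[OF U f] and G = lip_extension[OF U g]
    have "AE x in ?R. E (\<lambda>y. a * f y + b * g y) x
        = D (\<lambda>y. a * lip_extension M U f y + b * lip_extension M U g y) x"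
      by (rule E[OF Lip_inf_lincomb[OF f g] Lip_inf_lincomb[OF F(1) G(1)]]) (simp add: F G)
    with AE_R[OF Der_linear[OF D F(1) G(1), of a b]]
    show "AE x in ?R. E (\<lambda>y. a * f y + b * g y) x = a * E f x + b * E g x"
      unfolding E_def by eventually_elim simp
  next
    fix f g assume f: "f \<in> Lip_inf ?R" and g: "g \<in> Lip_inf ?R"
    note F = lip_extension[OF U f] and G = lip_extension[OF U g]
    have "AE x in ?R. E (\<lambda>y. f y * g y) x
        = D (\<lambda>y. lip_extension M U f y * lip_extension M U g y) x"
      by (rule E[OF Lip_inf_mult[OF f g] Lip_inf_mult[OF F(1) G(1)]]) (simp add: F G)
    moreover have "AE x in ?R. x \<in> U" by (simp add: AE_restrict[OF U])
    ultimately show "AE x in ?R. E (\<lambda>y. f y * g y) x = E f x * g x + f x * E g x"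
      using AE_R[OF Der_product[OF D F(1) G(1)]]
      unfolding E_def by eventually_elim (simp add: F G)
  next
    fix f K assume f: "f \<in> lip_ball ?R K"
    obtain F where F: "F \<in> lip_ball M K" "\<And>x. x \<in> U \<Longrightarrow> F x = f x"
      using lip_ball_extend[OF U f] by blast
    have "AE x in ?R. E f x = D F x" by (rule E[OF Lip_infI[OF f] Lip_infI[OF F(1)] F(2)])
    with AE_R[OF C(2)[OF F(1)]] show "AE x in ?R. \<bar>E f x\<bar> \<le> C * K" by eventually_elim simp
  next
    fix f :: "nat \<Rightarrow> 'a \<Rightarrow> real" and g K
    assume f: "\<And>n. f n \<in> lip_ball ?R K" and g: "g \<in> lip_ball ?R K"
      and lim: "\<And>x. x \<in> space ?R \<Longrightarrow> (\<lambda>n. f n x) \<longlonglongrightarrow> g x"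
    have "\<forall>n. \<exists>F. F \<in> lip_ball M K \<and> (\<forall>x\<in>U. F x = f n x)"
    proof
      fix n show "\<exists>F. F \<in> lip_ball M K \<and> (\<forall>x\<in>U. F x = f n x)"
        by (rule lip_ball_extend[OF U f[of n]]) blast
    qed
    from choice[OF this] obtain F where
      "\<forall>n. F n \<in> lip_ball M K \<and> (\<forall>x\<in>U. F n x = f n x)" ..
    then have F: "\<And>n. F n \<in> lip_ball M K" "\<And>n x. x \<in> U \<Longrightarrow> F n x = f n x" by auto
    show "L_inf_weak_star_tendsto ?R (\<lambda>n. E (f n)) (E g)"
      unfolding L_inf_weak_star_tendsto_def
    proof (intro allI impI)
      fix h :: "'a \<Rightarrow> real" assume h: "integrable ?R h"
      define k where "k x = indicator U x * h x" for x
      have k: "integrable M k" using h unfolding k_def by (simp add: integrable_restrict_iff[OF U])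
      have int: "(\<integral>x. E u x * h x \<partial>?R) = (\<integral>x. D v x * k x \<partial>M)"
        if u: "u \<in> lip_ball ?R K" and v: "v \<in> lip_ball M K" and eq: "\<And>x. x \<in> U \<Longrightarrow> v x = u x" for u v
      proof -
        have Eu: "E u \<in> L_inf ?R"
          unfolding E_def
          by (intro L_inf_restrict[OF U] Der_L_inf[OF D] lip_extension[OF U Lip_infI[OF u]])
        have Dv: "D v \<in> L_inf ?R"
          by (intro L_inf_restrict[OF U] Der_L_inf[OF D] Lip_infI[OF v])
        have "(\<integral>x. E u x * h x \<partial>?R) = (\<integral>x. D v x * h x \<partial>?R)"
        proof (rule integral_cong_AE)
          show "(\<lambda>x. E u x * h x) \<in> borel_measurable ?R"
            by (rule borel_measurable_integrable[OF integrable_L_inf_mult[OF Eu h]])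
          show "(\<lambda>x. D v x * h x) \<in> borel_measurable ?R"
            by (rule borel_measurable_integrable[OF integrable_L_inf_mult[OF Dv h]])
          show "AE x in ?R. E u x * h x = D v x * h x"
            proof -
          have "AE x in ?R. E u x = D v x" by (rule E[OF Lip_infI[OF u] Lip_infI[OF v] eq])
          then show ?thesis by eventually_elim simp
        qed
        qed
        also have "\<dots> = (\<integral>x. D v x * k x \<partial>M)"
          unfolding integral_restrict[OF U] k_def by (rule Bochner_Integration.integral_cong) auto
        finally show ?thesis .
      qed
      show "(\<lambda>n. \<integral>x. E (f n) x * h x \<partial>?R) \<longlonglongrightarrow> (\<integral>x. E g x * h x \<partial>?R)"
      proof (rule ccontr)
        let ?a = "\<lambda>n. \<integral>x. E (f n) x * h x \<partial>?R" and ?l = "\<integral>x. E g x * h x \<partial>?R"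
        assume "\<not> ?a \<longlonglongrightarrow> ?l"
        then obtain e where e: "0 < e" "\<not> (\<forall>\<^sub>F n in sequentially. dist (?a n) ?l < e)"
          unfolding tendsto_iff by blast
        from not_eventually_sequentiallyD[OF e(2)] obtain r :: "nat \<Rightarrow> nat" where
          r: "strict_mono r" "\<And>n. \<not> dist (?a (r n)) ?l < e" by blast
        obtain s G where s: "strict_mono (s :: nat \<Rightarrow> nat)" and G: "G \<in> lip_ball M K"
          and FG: "\<And>x. x \<in> space M \<Longrightarrow> (\<lambda>n. F (r (s n)) x) \<longlonglongrightarrow> G x"
          using lip_ball_seq_compact[OF M(1), of "\<lambda>n. F (r n)" K] F(1) by blast
        have "G x = g x" if x: "x \<in> U" for x
        proof (rule LIMSEQ_unique)
          have "x \<in> space M" using sets.sets_into_space[OF U] x by blast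
          from FG[OF this] show "(\<lambda>n. f (r (s n)) x) \<longlonglongrightarrow> G x" by (simp add: F(2)[OF x])
          have "(\<lambda>n. f n x) \<longlonglongrightarrow> g x" using lim x U by simp
          from LIMSEQ_subseq_LIMSEQ[OF this strict_mono_o[OF r(1) s]]
          show "(\<lambda>n. f (r (s n)) x) \<longlonglongrightarrow> g x" by (simp add: o_def)
        qed
        then have "?l = (\<integral>x. D G x * k x \<partial>M)" using int[OF g G] by blast
        moreover have "?a (r (s n)) = (\<integral>x. D (F (r (s n))) x * k x \<partial>M)" for n
          by (rule int[OF f F(1) F(2)])
        moreover have "(\<lambda>n. \<integral>x. D (F (r (s n))) x * k x \<partial>M) \<longlonglongrightarrow> (\<integral>x. D G x * k x \<partial>M)"
          using Der_weak_star[OF D F(1) G FG] k by (simp add: L_inf_weak_star_tendsto_def)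
        ultimately have "(\<lambda>n. ?a (r (s n))) \<longlonglongrightarrow> ?l" by simp
        from tendstoD[OF this e(1)] have "\<forall>\<^sub>F n in sequentially. False"
          using r(2) by simp
        then show False by simp
      qed
    qed
  qed
  then show ?thesis
  proof (intro bexI ballI impI)
    fix f F assume "f \<in> Lip_inf ?R" "F \<in> Lip_inf M" "\<forall>x\<in>U. F x = f x"
    then show "AE x in ?R. E f x = D F x" by (intro E) auto
  qed
qed

section \<open>Frames\<close>

text \<open>
  A frame of length \<open>k\<close> on \<open>V\<close> consists of derivations with dual Lipschitz functions. The uniform
  bounds matter when frames on countably many pieces are glued: they make the glued derivations
  bounded, and the coefficients \<open>E (f\<^sub>i)\<close> of a derivation \<open>E\<close> bounded as well. The bound
  \<open>3\<^sup>k\<close> is what the inductive construction yields.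
\<close>

definition der_frame ::
    "'a::metric_space measure \<Rightarrow> 'a set \<Rightarrow> nat \<Rightarrow> (nat \<Rightarrow> 'a lip_operator) \<Rightarrow> (nat \<Rightarrow> 'a \<Rightarrow> real) \<Rightarrow> bool" where
  "der_frame M V k D f \<longleftrightarrow>
     (\<forall>i<k. D i \<in> Der M) \<and> (\<forall>i<k. f i \<in> lip_ball M 1) \<and>
     (\<forall>i<k. \<forall>j<k. AE x in M. x \<in> V \<longrightarrow> D i (f j) x = (if i = j then 1 else 0)) \<and>
     (\<forall>i<k. \<forall>g\<in>lip_ball M 1. AE x in M. x \<in> V \<longrightarrow> \<bar>D i g x\<bar> \<le> 3 ^ k)"

definition der_frame_spans ::
    "'a::metric_space measure \<Rightarrow> 'a set \<Rightarrow> nat \<Rightarrow> (nat \<Rightarrow> 'a lip_operator) \<Rightarrow> (nat \<Rightarrow> 'a \<Rightarrow> real) \<Rightarrow> bool" where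
  "der_frame_spans M V k D f \<longleftrightarrow>
     (\<forall>E\<in>Der M. \<forall>g\<in>Lip_inf M. AE x in M. x \<in> V \<longrightarrow> E g x = (\<Sum>j<k. E (f j) x * D j g x))"

lemma AE_in_subset: "AE x in M. x \<in> V \<longrightarrow> P x \<Longrightarrow> W \<subseteq> V \<Longrightarrow> AE x in M. x \<in> W \<longrightarrow> P x"
  by (auto elim: eventually_mono)

lemma der_frame_subset:
  assumes "der_frame M V k D f" "W \<subseteq> V" shows "der_frame M W k D f"
  using assms(1) unfolding der_frame_def
  by (elim conjE, intro conjI allI impI ballI) (simp_all add: AE_in_subset[OF _ assms(2)])

lemma der_frame_spans_subset:
  assumes "der_frame_spans M V k D f" "W \<subseteq> V" shows "der_frame_spans M W k D f"
  using assms(1) unfolding der_frame_spans_def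
  by (intro ballI AE_in_subset[OF _ assms(2)]) simp

lemma AE_all_less:
  fixes k :: nat
  assumes "\<And>j. j < k \<Longrightarrow> AE x in M. P j x"
  shows "AE x in M. \<forall>j<k. P j x"
proof -
  have "AE x in M. \<forall>j\<in>{..<k}. P j x" using assms by (intro AE_finite_allI) auto
  then show ?thesis by (simp add: Ball_def)
qed

lemma sum_delta_mult:
  fixes c :: "nat \<Rightarrow> real"
  assumes "j < k" "\<And>i. i < k \<Longrightarrow> d i = (if i = j then 1 else 0)"
  shows "(\<Sum>i<k. c i * d i) = c j"
proof -
  have "(\<Sum>i<k. c i * d i) = (\<Sum>i<k. if i = j then c i else 0)"
    using assms(2) by (intro sum.cong) auto
  also have "\<dots> = c j" using assms(1) by (simp add: sum.delta)
  finally show ?thesis .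
qed

text \<open>
  The derivations of a frame, restricted to \<open>V\<close>, form an independent family there: evaluating a
  linear combination at \<open>f\<^sub>j\<close> leaves its \<open>j\<close>-th coefficient.
\<close>

lemma der_frame_length_le:
  fixes M :: "'a::metric_space measure"
  assumes M: "metric_measure_space M" "sigma_finite_measure M"
    and N: "der_index_locally_bounded M N"
    and V: "V \<in> sets M" "emeasure M V > 0" and fr: "der_frame M V k D f"
  shows "k \<le> N"
proof -
  let ?R = "restrict_space M V"
  have D: "D i \<in> Der M" "f i \<in> lip_ball M 1" if "i < k" for i
    using fr that by (auto simp: der_frame_def)
  have "\<forall>i. \<exists>E. i < k \<longrightarrow> E \<in> Der ?R \<and> (\<forall>h\<in>Lip_inf M. AE x in ?R. E h x = D i h x)"
  proof
    fix i
    show "\<exists>E. i < k \<longrightarrow> E \<in> Der ?R \<and> (\<forall>h\<in>Lip_inf M. AE x in ?R. E h x = D i h x)"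
    proof (cases "i < k")
      case True
      from Der_restrict[OF M V(1) D(1)[OF True]] obtain E where E: "E \<in> Der ?R"
        "\<forall>f\<in>Lip_inf ?R. \<forall>F\<in>Lip_inf M. (\<forall>x\<in>V. F x = f x) \<longrightarrow> (AE x in ?R. E f x = D i F x)" ..
      have "\<forall>h\<in>Lip_inf M. AE x in ?R. E h x = D i h x"
        using E(2) Lip_inf_restrict[OF V(1)] by simp
      with E(1) show ?thesis by blast
    qed simp
  qed
  from choice[OF this] obtain E where E': "\<forall>i. i < k \<longrightarrow> E i \<in> Der ?R \<and>
    (\<forall>h\<in>Lip_inf M. AE x in ?R. E i h x = D i h x)" ..
  have E: "E i \<in> Der ?R" if "i < k" for i using E' that by blast
  have dual: "AE x in ?R. E i (f j) x = (if i = j then 1 else 0)" if "i < k" "j < k" for i j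
  proof -
    have "AE x in ?R. E i (f j) x = D i (f j) x" using E' that Lip_infI[OF D(2)] by blast
    moreover have "AE x in ?R. D i (f j) x = (if i = j then 1 else 0)"
      unfolding AE_restrict[OF V(1)] using fr that by (simp add: der_frame_def)
    ultimately show ?thesis by eventually_elim simp
  qed
  have fR: "f j \<in> Lip_inf ?R" if "j < k" for j
    by (rule Lip_inf_restrict[OF V(1) Lip_infI[OF D(2)[OF that]]])
  have distinct: "\<not> der_eq ?R (E i) (E j)" if ij: "i < k" "j < k" "i \<noteq> j" for i j
  proof
    assume "der_eq ?R (E i) (E j)"
    then have "AE x in ?R. E i (f i) x = E j (f i) x" using fR[OF ij(1)] by (simp add: der_eq_def)
    with dual[OF ij(1) ij(1)] dual[OF ij(2) ij(1)] have "AE x in ?R. False"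
      by eventually_elim (use ij(3) in simp)
    then have "AE x in M. x \<notin> V" by (simp add: AE_restrict[OF V(1)])
    then have "emeasure M V = 0" using AE_iff_null_sets[OF V(1)] by blast
    with V(2) show False by simp
  qed
  have "der_independent ?R k E"
    unfolding der_independent_def
  proof (intro allI impI, elim conjE)
    fix c j assume zero: "der_eq ?R (der_lincomb k c E) (\<lambda>f x. 0)" and j: "j < k"
    have "AE x in ?R. (\<Sum>i<k. c i x * E i (f j) x) = 0"
      using zero fR[OF j] by (simp add: der_eq_def der_lincomb_def)
    moreover have "AE x in ?R. \<forall>i<k. E i (f j) x = (if i = j then 1 else 0)"
      by (rule AE_all_less) (rule dual[OF _ j])
    ultimately show "AE x in ?R. c j x = 0"
      by eventually_elim (simp add: sum_delta_mult[OF j])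
  qed
  moreover have "der_finite_index ?R" "der_index ?R \<le> N"
    using N V by (auto simp: der_index_locally_bounded_def)
  moreover have "der_index_bound ?R (der_index ?R)"
    using \<open>der_finite_index ?R\<close> unfolding der_finite_index_def der_index_def by (rule LeastI_ex)
  ultimately show "k \<le> N"
    using E distinct unfolding der_index_bound_def by (meson order_trans)
qed

text \<open>
  If a frame does not span, then \<open>E' = E - \<Sum> E (f\<^sub>j) D\<^sub>j\<close> annihilates all \<open>f\<^sub>j\<close> but is not zero.
  The new function \<open>h\<close> and the set \<open>W\<close> are chosen such that \<open>E' h\<close> is on \<open>W\<close> at least half of what
  \<open>E'\<close> attains on the unit ball; dividing by it gives a derivation bounded by \<open>2\<close>, and
  correcting the old ones by a multiple of it at most triples their bounds.
\<close>

lemma der_frame_extend: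
  fixes M :: "'a::metric_space measure"
  assumes V: "V \<in> sets M" and fr: "der_frame M V k D f"
    and E: "E \<in> Der M" and g: "g \<in> Lip_inf M"
    and nspan: "\<not> (AE x in M. x \<in> V \<longrightarrow> E g x = (\<Sum>j<k. E (f j) x * D j g x))"
  obtains W D' f' where "W \<in> sets M" "W \<subseteq> V" "emeasure M W > 0" "der_frame M W (Suc k) D' f'"
proof -
  have D: "D i \<in> Der M" "f i \<in> lip_ball M 1" if "i < k" for i
    using fr that by (auto simp: der_frame_def)
  have dual: "AE x in M. x \<in> V \<longrightarrow> D i (f j) x = (if i = j then 1 else 0)" if "i < k" "j < k" for i j
    using fr that by (simp add: der_frame_def)
  have bound: "AE x in M. x \<in> V \<longrightarrow> \<bar>D i u x\<bar> \<le> 3 ^ k" if "i < k" "u \<in> lip_ball M 1" for i u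
    using fr that by (simp add: der_frame_def)
  define E' where "E' = (\<lambda>u x. E u x + der_lincomb k (\<lambda>j x. - E (f j) x) D u x)"
  have E': "E' \<in> Der M" unfolding E'_def
    by (intro Der_add E Der_lincomb L_inf_uminus Der_L_inf[OF E] Lip_infI[OF D(2)] D(1))
  have E'_eq: "E' u x = E u x - (\<Sum>j<k. E (f j) x * D j u x)" for u x
    by (simp add: E'_def der_lincomb_def sum_negf)
  have E'_f: "AE x in M. x \<in> V \<longrightarrow> E' (f j) x = 0" if j: "j < k" for j
  proof -
    have "AE x in M. \<forall>i<k. x \<in> V \<longrightarrow> D i (f j) x = (if i = j then 1 else 0)"
      by (rule AE_all_less) (rule dual[OF _ j])
    then show ?thesis by eventually_elim (simp add: E'_eq sum_delta_mult[OF j])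
  qed
  define S where "S t \<longleftrightarrow> (\<exists>u\<in>lip_ball M 1. \<not> (AE x in M. x \<in> V \<longrightarrow> \<bar>E' u x\<bar> \<le> t))" for t :: real
  have "\<exists>t>0. S t"
  proof (rule ccontr)
    assume none: "\<not> (\<exists>t>0. S t)"
    obtain K where K: "g \<in> lip_ball M K" using g by (auto simp: Lip_inf_iff)
    define u where "u = (\<lambda>x. (1 / (K + 1)) * g x + 0 * g x)"
    have K0: "0 \<le> K" by (rule lip_ballD(1)[OF K])
    have "u \<in> lip_ball M 1" unfolding u_def
      by (rule lip_ball_mono[OF lip_ball_lincomb[OF K K]]) (use K0 in simp)
    then have "AE x in M. x \<in> V \<longrightarrow> \<bar>E' u x\<bar> \<le> 1 / real (Suc n)" for n
      using none by (auto simp: S_def)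
    then have "\<forall>n. AE x in M. x \<in> V \<longrightarrow> \<bar>E' u x\<bar> \<le> 1 / real (Suc n)" by blast
    then have "AE x in M. \<forall>n. x \<in> V \<longrightarrow> \<bar>E' u x\<bar> \<le> 1 / real (Suc n)"
      by (rule AE_all_countable[THEN iffD2])
    moreover have "AE x in M. E' u x = (1 / (K + 1)) * E' g x + 0 * E' g x"
      unfolding u_def by (rule Der_linear[OF E' g g])
    ultimately have "AE x in M. x \<in> V \<longrightarrow> E g x = (\<Sum>j<k. E (f j) x * D j g x)"
    proof eventually_elim
      case (elim x)
      show ?case
      proof
        assume x: "x \<in> V"
        have "\<bar>E' u x\<bar> \<le> 0"
        proof (rule field_le_epsilon)
          fix e :: real assume "0 < e"
          then obtain n where "1 / real (Suc n) < e" using nat_approx_posE by blast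
          with elim(1) x show "\<bar>E' u x\<bar> \<le> 0 + e" by (auto intro: order_trans less_imp_le)
        qed
        with elim(2) K0 have "E' g x = 0" by (auto simp: divide_le_0_iff)
        then show "E g x = (\<Sum>j<k. E (f j) x * D j g x)" by (simp add: E'_eq)
      qed
    qed
    with nspan show False by simp
  qed
  then obtain t1 where t1: "0 < t1" "S t1" by blast
  obtain C where C: "\<And>u K. u \<in> lip_ball M K \<Longrightarrow> AE x in M. \<bar>E' u x\<bar> \<le> C * K"
    using Der_bounded[OF E'] by blast
  have S_less: "t < C" if "S t" for t
  proof (rule ccontr)
    assume "\<not> t < C"
    have "AE x in M. x \<in> V \<longrightarrow> \<bar>E' u x\<bar> \<le> t" if "u \<in> lip_ball M 1" for u
      using C[OF that] by eventually_elim (use \<open>\<not> t < C\<close> in simp)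
    with that show False by (auto simp: S_def)
  qed
  \<comment> \<open>Otherwise \<open>S\<close> would hold for arbitrarily large numbers.\<close>
  have "\<exists>t>0. S t \<and> \<not> S (2 * t)"
  proof (rule ccontr)
    assume *: "\<not> (\<exists>t>0. S t \<and> \<not> S (2 * t))"
    have S_pow: "S (2 ^ n * t1)" for n
    proof (induction n)
      case (Suc n)
      have "0 < 2 ^ n * t1" using t1(1) by simp
      with * Suc show ?case by (auto simp: mult.assoc)
    qed (use t1 in simp)
    obtain n where "C / t1 < 2 ^ n" using real_arch_pow[of 2 "C / t1"] by auto
    then have "C < 2 ^ n * t1" using t1(1) by (simp add: field_simps)
    with S_less[OF S_pow[of n]] show False by simp
  qed
  then obtain t where t: "0 < t" "S t" "\<not> S (2 * t)" by blast
  from t(2) obtain h where h: "h \<in> lip_ball M 1"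
    and hS: "\<not> (AE x in M. x \<in> V \<longrightarrow> \<bar>E' h x\<bar> \<le> t)" by (auto simp: S_def)
  have E'_le: "AE x in M. x \<in> V \<longrightarrow> \<bar>E' u x\<bar> \<le> 2 * t" if "u \<in> lip_ball M 1" for u
    using t(3) that by (auto simp: S_def)
  have [measurable]: "E' h \<in> borel_measurable M"
    by (rule L_inf_measurable[OF Der_L_inf[OF E' Lip_infI[OF h]]])
  define W where "W = {x \<in> space M. t < \<bar>E' h x\<bar>} \<inter> V"
  have W: "W \<in> sets M" unfolding W_def using V by measurable
  have WV: "W \<subseteq> V" by (auto simp: W_def)
  have W_pos: "emeasure M W > 0"
  proof (rule ccontr)
    assume "\<not> emeasure M W > 0"
    then have "W \<in> null_sets M" using W by (intro null_setsI) simp_all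
    from AE_not_in[OF this] have "AE x in M. x \<in> V \<longrightarrow> \<bar>E' h x\<bar> \<le> t"
      using AE_space by eventually_elim (auto simp: W_def)
    with hS show False by simp
  qed
  define c where "c x = (if x \<in> W then 1 / E' h x else 0)" for x
  have W_h: "t < \<bar>E' h x\<bar>" "E' h x \<noteq> 0" if "x \<in> W" for x
    using that t(1) by (auto simp: W_def)
  have c: "c \<in> L_inf M"
  proof (rule L_infI)
    show "c \<in> borel_measurable M" unfolding c_def[abs_def] using W by measurable
    have "\<bar>c x\<bar> \<le> 1 / t" for x
    proof (cases "x \<in> W")
      case True
      have "1 / \<bar>E' h x\<bar> \<le> 1 / t" using W_h(1)[OF True] t(1) by (intro frac_le) auto
      with True show ?thesis by (simp add: c_def)
    qed (use t(1) in \<open>simp add: c_def\<close>)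
    then show "AE x in M. \<bar>c x\<bar> \<le> 1 / t" by simp
  qed
  define F where "F = (\<lambda>u x. c x * E' u x)"
  have F: "F \<in> Der M" unfolding F_def by (rule Der_scale[OF c E'])
  have F_f: "AE x in M. x \<in> W \<longrightarrow> F (f j) x = 0" if "j < k" for j
    using E'_f[OF that] by eventually_elim (use WV in \<open>auto simp: F_def\<close>)
  have F_h: "F h x = 1" if "x \<in> W" for x
    using W_h[OF that] that by (simp add: F_def c_def)
  have F_le: "AE x in M. x \<in> W \<longrightarrow> \<bar>F u x\<bar> \<le> 2" if "u \<in> lip_ball M 1" for u
    using E'_le[OF that]
  proof eventually_elim
    case (elim x)
    show ?case
    proof
      assume x: "x \<in> W"
      with WV elim have "\<bar>E' u x\<bar> \<le> 2 * \<bar>E' h x\<bar>" using W_h[OF x] by auto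
      then show "\<bar>F u x\<bar> \<le> 2" using x W_h[OF x] by (simp add: F_def c_def abs_mult field_simps)
    qed
  qed
  define D' where "D' i = (if i < k then (\<lambda>u x. D i u x + (- D i h x) * F u x) else F)" for i
  define f' where "f' i = (if i < k then f i else h)" for i
  have "der_frame M W (Suc k) D' f'"
    unfolding der_frame_def
  proof (intro conjI allI impI ballI)
    fix i assume "i < Suc k"
    show "D' i \<in> Der M"
    proof (cases "i < k")
      case True
      then show ?thesis
        unfolding D'_def if_P[OF True]
        by (intro Der_add Der_scale L_inf_uminus F D(1) Der_L_inf[OF D(1)] Lip_infI[OF h])
    qed (simp add: D'_def F)
    show "f' i \<in> lip_ball M 1" using D(2) h by (simp add: f'_def)
  next
    fix i j assume "i < Suc k" "j < Suc k"
    then consider "i < k" "j < k" | "i < k" "j = k" | "i = k" "j < k" | "i = k" "j = k" by linarith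
    then show "AE x in M. x \<in> W \<longrightarrow> D' i (f' j) x = (if i = j then 1 else 0)"
    proof cases
      case 1
      from dual[OF 1] F_f[OF 1(2)] show ?thesis
        by eventually_elim (use WV 1 in \<open>auto simp: D'_def f'_def\<close>)
    next
      case 2
      then show ?thesis by (simp add: D'_def f'_def F_h)
    next
      case 3
      from F_f[OF 3(2)] 3 show ?thesis by (simp add: D'_def f'_def)
    next
      case 4
      then show ?thesis by (simp add: D'_def f'_def F_h)
    qed
  next
    fix i u assume i: "i < Suc k" and u: "u \<in> lip_ball M 1"
    show "AE x in M. x \<in> W \<longrightarrow> \<bar>D' i u x\<bar> \<le> 3 ^ Suc k"
    proof (cases "i < k")
      case True
      from bound[OF True u] bound[OF True h] F_le[OF u] show ?thesis
      proof eventually_elim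
        case (elim x)
        show ?case
        proof
          assume x: "x \<in> W"
          then have "\<bar>D i h x\<bar> * \<bar>F u x\<bar> \<le> 3 ^ k * 2" using elim WV by (intro mult_mono) auto
          moreover have "\<bar>D i u x\<bar> \<le> 3 ^ k" using elim WV x by auto
          moreover have "\<bar>D' i u x\<bar> \<le> \<bar>D i u x\<bar> + \<bar>D i h x\<bar> * \<bar>F u x\<bar>"
            using abs_triangle_ineq[of "D i u x" "- D i h x * F u x"]
            by (simp add: D'_def True abs_mult)
          ultimately show "\<bar>D' i u x\<bar> \<le> 3 ^ Suc k" by simp
        qed
      qed
    next
      case False
      have "(1::real) \<le> 3 ^ k" by (rule one_le_power) simp
      then have "(2::real) \<le> 3 ^ Suc k" unfolding power_Suc by linarith
      with F_le[OF u] show ?thesis by (auto simp: D'_def False elim!: eventually_mono)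
    qed
  qed
  with W WV W_pos show thesis by (rule that)
qed

text \<open>
  Frames on subsets of \<open>U\<close> of positive measure have length at most \<open>N\<close>. One of maximal length spans,
  since otherwise it could be extended on a smaller set.
\<close>

lemma exists_spanning_frame:
  fixes M :: "'a::metric_space measure"
  assumes M: "metric_measure_space M" "sigma_finite_measure M"
    and N: "der_index_locally_bounded M N" and U: "U \<in> sets M" "emeasure M U > 0"
  shows "\<exists>V k D f. V \<in> sets M \<and> V \<subseteq> U \<and> emeasure M V > 0 \<and> k \<le> N \<and>
    der_frame M V k D f \<and> der_frame_spans M V k D f"
proof -
  define P where "P k \<longleftrightarrow> (\<exists>V D f. V \<in> sets M \<and> V \<subseteq> U \<and> emeasure M V > 0 \<and> der_frame M V k D f)" for k
  have "P 0" using U by (auto simp: P_def der_frame_def)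
  moreover have P_le: "k \<le> N" if "P k" for k
    using that der_frame_length_le[OF M N] by (auto simp: P_def)
  ultimately obtain k where k: "P k" "\<And>l. P l \<Longrightarrow> l \<le> k"
    using ex_has_greatest_nat[of P 0 "\<lambda>k. k" "Suc N"] by (auto simp: less_Suc_eq_le)
  then obtain V D f where V: "V \<in> sets M" "V \<subseteq> U" "emeasure M V > 0" and fr: "der_frame M V k D f"
    by (auto simp: P_def)
  have "der_frame_spans M V k D f"
    unfolding der_frame_spans_def
  proof (intro ballI, rule ccontr)
    fix E g assume E: "E \<in> Der M" "g \<in> Lip_inf M"
      and "\<not> (AE x in M. x \<in> V \<longrightarrow> E g x = (\<Sum>j<k. E (f j) x * D j g x))"
    from der_frame_extend[OF V(1) fr this] obtain W D' f' where
      "W \<in> sets M" "W \<subseteq> V" "emeasure M W > 0" "der_frame M W (Suc k) D' f'" by blast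
    then have "P (Suc k)" using V(2) unfolding P_def by blast
    from k(2)[OF this] show False by simp
  qed
  then show ?thesis using V fr P_le[OF k(1)] by blast
qed

section \<open>Exhaustion\<close>

text \<open>
  A countable union of sets satisfying \<open>P\<close> that is maximal for a finite measure equivalent to
  \<open>M\<close> has a null complement, since otherwise one more set could be added to it.
\<close>

lemma disjoint_cover_if_locally_exists:
  assumes M: "sigma_finite_measure M"
    and empty: "P {}" and hered: "\<And>A B. P B \<Longrightarrow> A \<subseteq> B \<Longrightarrow> P A"
    and ex: "\<And>U. U \<in> sets M \<Longrightarrow> emeasure M U > 0 \<Longrightarrow>
      \<exists>V. V \<in> sets M \<and> V \<subseteq> U \<and> emeasure M V > 0 \<and> P V"
  obtains A :: "nat \<Rightarrow> 'a set" where "range A \<subseteq> sets M" "\<And>n. P (A n)" "disjoint_family A"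
    "emeasure M (space M - (\<Union>n. A n)) = 0"
proof -
  obtain w :: "'a \<Rightarrow> real" where w: "w \<in> borel_measurable M" "\<And>x. 0 < w x" "\<And>x. w x \<le> 1" "integrable M w"
    by (rule sigma_finite_measure.obtain_positive_integrable_function[OF M], rule that)
  \<comment> \<open>A finite measure with the same null sets.\<close>
  define Q where "Q = density M (\<lambda>x. ennreal (w x))"
  have sets_Q: "sets Q = sets M" by (simp add: Q_def)
  have w0: "ennreal (w x) \<noteq> 0" for x using w(2)[of x] by simp
  have Q_null: "emeasure Q A = 0 \<longleftrightarrow> emeasure M A = 0" if A: "A \<in> sets M" for A
  proof -
    have "A \<in> null_sets Q \<longleftrightarrow> (AE x in M. x \<notin> A)"
      using A w(1) unfolding Q_def by (subst null_sets_density_iff) (simp_all add: w0)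
    also have "\<dots> \<longleftrightarrow> A \<in> null_sets M" using A by (simp add: AE_iff_null_sets)
    finally show ?thesis using A by (simp add: null_sets_def sets_Q)
  qed
  have "emeasure Q (space M) = (\<integral>\<^sup>+x. ennreal (w x) \<partial>M)"
    unfolding Q_def using w(1) by (subst emeasure_density) (auto intro!: nn_integral_cong simp: indicator_def)
  also have "\<dots> < \<infinity>"
    using w(4) less_imp_le[OF w(2)] by (simp add: nn_integral_eq_integral)
  finally have Q_fin: "emeasure Q A < \<infinity>" if "A \<in> sets M" for A
    using emeasure_mono[of A "space M" Q] sets.sets_into_space[OF that] sets_Q
    by (metis le_less_trans sets.top)
  define X where "X = {emeasure Q (\<Union>n::nat. B n) |B. \<forall>n. B n \<in> sets M \<and> P (B n)}"
  have "emeasure Q (\<Union>n::nat. {}) \<in> X" using empty unfolding X_def by blast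
  then have "X \<noteq> {}" by blast
  from ennreal_Sup_countable_SUP[OF this] obtain q :: "nat \<Rightarrow> ennreal"
    where q: "range q \<subseteq> X" "Sup X = (SUP i. q i)" by blast
  have "\<forall>m. \<exists>B. q m = emeasure Q (\<Union>n::nat. B n) \<and> (\<forall>n. B n \<in> sets M \<and> P (B n))"
    using q(1) unfolding X_def by blast
  from choice[OF this] obtain B where
    B: "\<forall>m. q m = emeasure Q (\<Union>n::nat. B m n) \<and> (\<forall>n. B m n \<in> sets M \<and> P (B m n))" ..
  define B' where "B' n = (case prod_decode n of (i, j) \<Rightarrow> B i j)" for n
  have B': "B' n \<in> sets M" "P (B' n)" for n
    using B by (auto simp: B'_def split: prod.split)
  have UB': "(\<Union>n. B' n) \<in> sets M" using B'(1) by auto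
  have "q m \<le> emeasure Q (\<Union>n. B' n)" for m
  proof -
    have "(\<Union>n. B m n) \<subseteq> (\<Union>n. B' n)"
    proof
      fix x assume "x \<in> (\<Union>n. B m n)"
      then obtain n where "x \<in> B m n" by blast
      then have "x \<in> B' (prod_encode (m, n))" by (simp add: B'_def)
      then show "x \<in> (\<Union>n. B' n)" by blast
    qed
    then show ?thesis using B UB' sets_Q by (auto intro!: emeasure_mono)
  qed
  then have sup: "Sup X \<le> emeasure Q (\<Union>n. B' n)" unfolding q(2) by (rule SUP_least)
  have null: "emeasure M (space M - (\<Union>n. B' n)) = 0"
  proof (rule ccontr)
    assume "emeasure M (space M - (\<Union>n. B' n)) \<noteq> 0"
    then have "emeasure M (space M - (\<Union>n. B' n)) > 0" by (simp add: zero_less_iff_neq_zero)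
    from ex[OF _ this] UB' obtain V where V: "V \<in> sets M" "V \<subseteq> space M - (\<Union>n. B' n)"
      "emeasure M V > 0" "P V" by blast
    define B'' where "B'' n = (case n of 0 \<Rightarrow> V | Suc m \<Rightarrow> B' m)" for n
    have "emeasure Q (\<Union>n. B'' n) \<in> X"
      unfolding X_def using B' V by (auto simp: B''_def split: nat.split intro!: exI[of _ B''])
    then have "emeasure Q (\<Union>n. B'' n) \<le> emeasure Q (\<Union>n. B' n)"
      using sup by (meson Sup_upper order_trans)
    moreover have "(\<Union>n. B'' n) = V \<union> (\<Union>n. B' n)"
    proof (intro set_eqI iffI)
      fix x assume "x \<in> (\<Union>n. B'' n)"
      then obtain n where "x \<in> B'' n" by blast
      then show "x \<in> V \<union> (\<Union>n. B' n)" by (cases n) (auto simp: B''_def)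
    next
      fix x assume "x \<in> V \<union> (\<Union>n. B' n)"
      then have "x \<in> B'' 0 \<or> (\<exists>n. x \<in> B'' (Suc n))" by (auto simp: B''_def)
      then show "x \<in> (\<Union>n. B'' n)" by blast
    qed
    moreover have "emeasure Q (V \<union> (\<Union>n. B' n)) = emeasure Q V + emeasure Q (\<Union>n. B' n)"
      using V UB' sets_Q by (intro plus_emeasure[symmetric]) auto
    ultimately have "emeasure Q (\<Union>n. B' n) + emeasure Q V \<le> emeasure Q (\<Union>n. B' n) + 0"
      by (simp add: add.commute)
    then have "emeasure Q V = 0" using Q_fin[OF UB'] by (auto simp: ennreal_add_left_cancel_le)
    with Q_null[OF V(1)] V(3) show False by simp
  qed
  show thesis
  proof (rule that[of "disjointed B'"])
    show "range (disjointed B') \<subseteq> sets M" using B'(1) by (intro sets.range_disjointed_sets) auto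
    show "P (disjointed B' n)" for n by (rule hered[OF B'(2) disjointed_subset])
    show "disjoint_family (disjointed B')" by (rule disjoint_family_disjointed)
    show "emeasure M (space M - (\<Union>n. disjointed B' n)) = 0" by (simp only: UN_disjointed_eq null)
  qed
qed

section \<open>Gluing\<close>

text \<open>
  The sets \<open>A n\<close> are meant to be disjoint, so that the series has at most one nonzero term;
  as a series the function is evidently measurable.
\<close>

definition piecewise :: "(nat \<Rightarrow> 'a set) \<Rightarrow> (nat \<Rightarrow> 'a \<Rightarrow> real) \<Rightarrow> 'a \<Rightarrow> real" where
  "piecewise A u x = (\<Sum>n. indicator (A n) x * u n x)"

lemma piecewise_in:
  assumes "disjoint_family A" "x \<in> A n"
  shows "piecewise A u x = u n x"
proof -
  have "x \<notin> A m" if "m \<noteq> n" for m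
    using assms that by (auto simp: disjoint_family_on_def)
  then show ?thesis
    unfolding piecewise_def using assms(2) by (subst suminf_finite[of "{n}"]) auto
qed

lemma piecewise_out: "x \<notin> (\<Union>n. A n) \<Longrightarrow> piecewise A u x = 0"
  by (simp add: piecewise_def)

lemma AE_pieces:
  fixes A :: "nat \<Rightarrow> 'a set"
  assumes "\<And>n. AE x in M. x \<in> A n \<longrightarrow> P x"
  shows "AE x in M. x \<in> (\<Union>n. A n) \<longrightarrow> P x"
proof -
  have "\<forall>n. AE x in M. x \<in> A n \<longrightarrow> P x" using assms by blast
  then have "AE x in M. \<forall>n. x \<in> A n \<longrightarrow> P x" by (rule AE_all_countable[THEN iffD2])
  then show ?thesis by eventually_elim blast
qed

lemma AE_piecewise:
  fixes A :: "nat \<Rightarrow> 'a set"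
  assumes "\<And>n. AE x in M. x \<in> A n \<longrightarrow> P x" "\<And>x. x \<notin> (\<Union>n. A n) \<Longrightarrow> P x"
  shows "AE x in M. P x"
proof -
  have "AE x in M. x \<in> (\<Union>n. A n) \<longrightarrow> P x" by (rule AE_pieces) (rule assms(1))
  then show ?thesis by eventually_elim (use assms(2) in blast)
qed

lemma L_inf_piecewise:
  assumes A: "range A \<subseteq> sets M" "disjoint_family A"
    and u: "\<And>n. u n \<in> L_inf M" and C: "0 \<le> C" "\<And>n. AE x in M. x \<in> A n \<longrightarrow> \<bar>u n x\<bar> \<le> C"
  shows "piecewise A u \<in> L_inf M"
proof (rule L_infI)
  have [measurable]: "A n \<in> sets M" "u n \<in> borel_measurable M" for n
    using A(1) L_inf_measurable[OF u] by auto
  show "piecewise A u \<in> borel_measurable M"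
    unfolding piecewise_def[abs_def] by measurable
  show "AE x in M. \<bar>piecewise A u x\<bar> \<le> C"
  proof (rule AE_piecewise[of A])
    fix n show "AE x in M. x \<in> A n \<longrightarrow> \<bar>piecewise A u x\<bar> \<le> C"
      using C(2)[of n] by eventually_elim (simp add: piecewise_in[OF A(2)])
  qed (simp add: piecewise_out C(1))
qed

text \<open>
  Dividing \<open>u\<close> by \<open>K\<close> reduces this to the unit ball, except for \<open>K = 0\<close>, where \<open>D u = 0\<close>.
\<close>

lemma Der_bound_scale:
  assumes D: "D \<in> Der M" and C: "\<And>u. u \<in> lip_ball M 1 \<Longrightarrow> AE x in M. x \<in> V \<longrightarrow> \<bar>D u x\<bar> \<le> C"
    and u: "u \<in> lip_ball M K"
  shows "AE x in M. x \<in> V \<longrightarrow> \<bar>D u x\<bar> \<le> C * K"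
proof (cases "K = 0")
  case True
  obtain B where "\<And>f K. f \<in> lip_ball M K \<Longrightarrow> AE x in M. \<bar>D f x\<bar> \<le> B * K"
    using Der_bounded[OF D] by blast
  from this[OF u] show ?thesis by eventually_elim (simp add: True)
next
  case False
  then have K: "0 < K" using lip_ballD(1)[OF u] by simp
  let ?v = "\<lambda>x. (1 / K) * u x + 0 * u x"
  have "?v \<in> lip_ball M 1"
    by (rule lip_ball_mono[OF lip_ball_lincomb[OF u u]]) (use K in simp)
  from C[OF this] Der_linear[OF D Lip_infI[OF u] Lip_infI[OF u], of "1 / K" 0]
  show ?thesis
  proof eventually_elim
    case (elim x)
    show ?case
    proof
      assume x: "x \<in> V"
      have "D u x = K * D ?v x" using elim(2) K by simp
      then have "\<bar>D u x\<bar> = \<bar>D ?v x\<bar> * K" using K by (simp only: abs_mult abs_of_pos mult.commute)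
      also have "\<dots> \<le> C * K" using elim(1) x K by (intro mult_right_mono) auto
      finally show "\<bar>D u x\<bar> \<le> C * K" .
    qed
  qed
qed

lemma summable_integral_pieces:
  fixes h :: "'a \<Rightarrow> real"
  assumes A: "range A \<subseteq> sets M" "disjoint_family A" and h: "integrable M h"
  shows "summable (\<lambda>n. \<integral>x. indicator (A n) x * \<bar>h x\<bar> \<partial>M)"
proof (rule summableI_nonneg_bounded)
  have int: "integrable M (\<lambda>x. indicator (A n) x * \<bar>h x\<bar>)" for n
    using A(1) h by (intro integrable_L_inf_mult L_inf_indicator) auto
  show "0 \<le> (\<integral>x. indicator (A n) x * \<bar>h x\<bar> \<partial>M)" for n
    by (rule integral_nonneg_AE) simp
  fix m
  have "(\<Sum>n<m. \<integral>x. indicator (A n) x * \<bar>h x\<bar> \<partial>M) = (\<integral>x. (\<Sum>n<m. indicator (A n) x * \<bar>h x\<bar>) \<partial>M)"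
    by (rule Bochner_Integration.integral_sum[symmetric]) (rule int)
  also have "\<dots> \<le> (\<integral>x. \<bar>h x\<bar> \<partial>M)"
  proof (rule integral_mono)
    show "integrable M (\<lambda>x. \<Sum>n<m. indicator (A n) x * \<bar>h x\<bar>)"
      by (rule Bochner_Integration.integrable_sum) (rule int)
    show "integrable M (\<lambda>x. \<bar>h x\<bar>)" using h by simp
    fix x
    have "disjoint_family_on A {..<m}" using A(2) by (rule disjoint_family_on_mono[rotated]) simp
    then have "(\<Sum>n<m. indicator (A n) x * \<bar>h x\<bar>) = indicator (\<Union>n<m. A n) x * \<bar>h x\<bar>"
      by (simp add: indicator_UN_disjoint sum_distrib_right)
    also have "\<dots> \<le> \<bar>h x\<bar>" by (simp add: indicator_def)
    finally show "(\<Sum>n<m. indicator (A n) x * \<bar>h x\<bar>) \<le> \<bar>h x\<bar>" .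
  qed
  finally show "(\<Sum>n<m. \<integral>x. indicator (A n) x * \<bar>h x\<bar> \<partial>M) \<le> (\<integral>x. \<bar>h x\<bar> \<partial>M)" .
qed

text \<open>
  The uniform bound gives both the boundedness of the glued operator and, by dominated convergence
  of the series of integrals over the pieces, its weak* continuity.
\<close>

lemma Der_piecewise:
  fixes M :: "'a::metric_space measure"
  assumes A: "range A \<subseteq> sets M" "disjoint_family A" and D: "\<And>n. D n \<in> Der M"
    and C: "0 \<le> C" "\<And>n u. u \<in> lip_ball M 1 \<Longrightarrow> AE x in M. x \<in> A n \<longrightarrow> \<bar>D n u x\<bar> \<le> C"
  shows "(\<lambda>u. piecewise A (\<lambda>n. D n u)) \<in> Der M"
proof (rule DerI[OF _ _ C(1)])
  note pw = piecewise_in[OF A(2)] piecewise_out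
  have bd: "AE x in M. x \<in> A n \<longrightarrow> \<bar>D n u x\<bar> \<le> C * K" if "u \<in> lip_ball M K" for n u K
    by (rule Der_bound_scale[OF D C(2) that])
  have A': "A n \<in> sets M" for n using A(1) by auto
  {
    fix u K assume u: "u \<in> lip_ball M K"
    have CK: "0 \<le> C * K" using C(1) lip_ballD(1)[OF u] by simp
    show "AE x in M. \<bar>piecewise A (\<lambda>n. D n u) x\<bar> \<le> C * K"
    proof (rule AE_piecewise[of A])
      fix n show "AE x in M. x \<in> A n \<longrightarrow> \<bar>piecewise A (\<lambda>n. D n u) x\<bar> \<le> C * K"
        using bd[OF u, of n] by eventually_elim (simp add: pw)
    qed (simp add: pw CK)
  }
  have L: "piecewise A (\<lambda>n. D n u) \<in> L_inf M" if u: "u \<in> lip_ball M K" for u K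
    using C(1) lip_ballD(1)[OF u]
    by (intro L_inf_piecewise[OF A Der_L_inf[OF D Lip_infI[OF u]] _ bd[OF u]]) simp
  then show "piecewise A (\<lambda>n. D n u) \<in> L_inf M" if "u \<in> Lip_inf M" for u
    using that by (auto simp: Lip_inf_iff)
  {
    fix u v a b assume uv: "u \<in> Lip_inf M" "v \<in> Lip_inf M"
    show "AE x in M. piecewise A (\<lambda>n. D n (\<lambda>y. a * u y + b * v y)) x
        = a * piecewise A (\<lambda>n. D n u) x + b * piecewise A (\<lambda>n. D n v) x"
    proof (rule AE_piecewise[of A])
      fix n show "AE x in M. x \<in> A n \<longrightarrow> piecewise A (\<lambda>n. D n (\<lambda>y. a * u y + b * v y)) x
        = a * piecewise A (\<lambda>n. D n u) x + b * piecewise A (\<lambda>n. D n v) x"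
        using Der_linear[OF D[of n] uv, of a b] by eventually_elim (simp add: pw)
    qed (simp add: pw)
    show "AE x in M. piecewise A (\<lambda>n. D n (\<lambda>y. u y * v y)) x
        = piecewise A (\<lambda>n. D n u) x * v x + u x * piecewise A (\<lambda>n. D n v) x"
    proof (rule AE_piecewise[of A])
      fix n show "AE x in M. x \<in> A n \<longrightarrow> piecewise A (\<lambda>n. D n (\<lambda>y. u y * v y)) x
        = piecewise A (\<lambda>n. D n u) x * v x + u x * piecewise A (\<lambda>n. D n v) x"
        using Der_product[OF D[of n] uv] by eventually_elim (simp add: pw)
    qed (simp add: pw)
  }
  fix f :: "nat \<Rightarrow> 'a \<Rightarrow> real" and g K
  assume f: "\<And>m. f m \<in> lip_ball M K" and g: "g \<in> lip_ball M K"
    and lim: "\<And>x. x \<in> space M \<Longrightarrow> (\<lambda>m. f m x) \<longlonglongrightarrow> g x"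
  show "L_inf_weak_star_tendsto M (\<lambda>m. piecewise A (\<lambda>n. D n (f m))) (piecewise A (\<lambda>n. D n g))"
    unfolding L_inf_weak_star_tendsto_def
  proof (intro allI impI)
    fix h :: "'a \<Rightarrow> real" assume h: "integrable M h"
    define I where "I n u = (\<integral>x. D n u x * (indicator (A n) x * h x) \<partial>M)" for n u
    have hA: "integrable M (\<lambda>x. indicator (A n) x * h x)" for n
      by (rule integrable_L_inf_mult[OF L_inf_indicator[OF A'] h])
    have total: "(\<integral>x. piecewise A (\<lambda>n. D n u) x * h x \<partial>M) = (\<Sum>n. I n u)"
      if u: "u \<in> lip_ball M K" for u
    proof -
      let ?p = "\<lambda>x. piecewise A (\<lambda>n. D n u) x * h x"
      have int: "integrable M ?p" by (rule integrable_L_inf_mult[OF L[OF u] h])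
      have "(\<integral>x. ?p x \<partial>M) = (LINT x:(\<Union>n. A n)|M. ?p x)"
        unfolding set_lebesgue_integral_def
        by (rule Bochner_Integration.integral_cong) (auto simp: indicator_def pw)
      also have "\<dots> = (\<Sum>n. LINT x:A n|M. ?p x)"
      proof (rule lebesgue_integral_countable_add[OF A'])
        show "A i \<inter> A j = {}" if "i \<noteq> j" for i j
          using A(2) that by (auto simp: disjoint_family_on_def)
        show "set_integrable M (\<Union>n. A n) ?p"
          unfolding set_integrable_def using A' by (intro integrable_mult_indicator int) auto
      qed
      also have "\<dots> = (\<Sum>n. I n u)"
        unfolding set_lebesgue_integral_def I_def
        by (intro suminf_cong Bochner_Integration.integral_cong) (auto simp: indicator_def pw)
      finally show ?thesis .
    qed
    have I_le: "\<bar>I n u\<bar> \<le> C * K * (\<integral>x. indicator (A n) x * \<bar>h x\<bar> \<partial>M)"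
      if u: "u \<in> lip_ball M K" for n u
    proof -
      have int: "integrable M (\<lambda>x. indicator (A n) x * \<bar>h x\<bar>)"
        using h by (intro integrable_L_inf_mult L_inf_indicator A') auto
      have intD: "integrable M (\<lambda>x. D n u x * (indicator (A n) x * h x))"
        by (rule integrable_L_inf_mult[OF Der_L_inf[OF D Lip_infI[OF u]] hA])
      have "norm (I n u) \<le> (\<integral>x. norm (D n u x * (indicator (A n) x * h x)) \<partial>M)"
        unfolding I_def by (rule integral_norm_bound)
      also have "\<dots> \<le> (\<integral>x. C * K * (indicator (A n) x * \<bar>h x\<bar>) \<partial>M)"
      proof (rule integral_mono_AE)
        show "integrable M (\<lambda>x. norm (D n u x * (indicator (A n) x * h x)))"
          using intD by (rule integrable_norm)
        show "integrable M (\<lambda>x. C * K * (indicator (A n) x * \<bar>h x\<bar>))" using int by simp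
        show "AE x in M. norm (D n u x * (indicator (A n) x * h x)) \<le> C * K * (indicator (A n) x * \<bar>h x\<bar>)"
          using bd[OF u, of n]
          by eventually_elim (auto simp: indicator_def abs_mult intro!: mult_right_mono)
      qed
      finally show ?thesis by simp
    qed
    have "(\<lambda>m. \<Sum>n. I n (f m)) \<longlonglongrightarrow> (\<Sum>n. I n g)"
    proof (rule conjunct2[OF conjunct2[OF tannerys_theorem]])
      show "(\<lambda>m. I n (f m)) \<longlonglongrightarrow> I n g" for n
        using Der_weak_star[OF D f g lim, of n] hA[of n] by (simp add: L_inf_weak_star_tendsto_def I_def)
      show "summable (\<lambda>n. C * K * (\<integral>x. indicator (A n) x * \<bar>h x\<bar> \<partial>M))"
        by (intro summable_mult summable_integral_pieces A h)
      show "\<forall>\<^sub>F (n, m) in at_top \<times>\<^sub>F sequentially.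
          norm (I n (f m)) \<le> C * K * (\<integral>x. indicator (A n) x * \<bar>h x\<bar> \<partial>M)"
        by (rule always_eventually) (use I_le[OF f] in auto)
    qed simp
    then show "(\<lambda>m. \<integral>x. piecewise A (\<lambda>n. D n (f m)) x * h x \<partial>M)
        \<longlonglongrightarrow> (\<integral>x. piecewise A (\<lambda>n. D n g) x * h x \<partial>M)"
      by (simp only: total[OF f] total[OF g])
  qed
qed

lemma der_frame_empty:
  "der_frame M {} k (\<lambda>i u x. 0) (\<lambda>i x. 0)" "der_frame_spans M {} k D f"
  by (auto simp: der_frame_def der_frame_spans_def Der_zero intro: lip_ballI)

text \<open>
  The glued derivations \<open>G i\<close> are a basis. They are independent because this can be checked on each
  \<open>A n\<close> with the functions dual to the frame on that piece. A derivation \<open>Q\<close> has the coefficient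
  \<open>Q (f n i)\<close> on \<open>A n\<close>; these are bounded uniformly in \<open>n\<close> because \<open>f n i\<close> lies in the unit ball.
\<close>

lemma der_free_of_rank_if_frames:
  fixes M :: "'a::metric_space measure" and A :: "nat \<Rightarrow> 'a set"
  assumes M: "metric_measure_space M" "sigma_finite_measure M"
    and A: "range A \<subseteq> sets M" "disjoint_family A"
    and fr: "\<And>n. \<exists>D f. der_frame M (A n) k D f \<and> der_frame_spans M (A n) k D f"
  shows "der_free_of_rank (restrict_space M (\<Union>n. A n)) k"
proof -
  define U where "U = (\<Union>n. A n)"
  let ?R = "restrict_space M U"
  have U: "U \<in> sets M" unfolding U_def using A(1) by auto
  have "\<forall>n. \<exists>p. der_frame M (A n) k (fst p) (snd p) \<and> der_frame_spans M (A n) k (fst p) (snd p)"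
    using fr by simp
  from choice[OF this] obtain p where
    p: "\<forall>n. der_frame M (A n) k (fst (p n)) (snd (p n)) \<and> der_frame_spans M (A n) k (fst (p n)) (snd (p n))" ..
  define D where "D n = fst (p n)" for n
  define f where "f n = snd (p n)" for n
  have fr: "der_frame M (A n) k (D n) (f n)" and sp: "der_frame_spans M (A n) k (D n) (f n)" for n
    using p by (auto simp: D_def f_def)
  have D: "D n i \<in> Der M" "f n i \<in> lip_ball M 1" if "i < k" for n i
    using fr[of n] that by (auto simp: der_frame_def)
  have dual: "AE x in M. x \<in> A n \<longrightarrow> D n i (f n j) x = (if i = j then 1 else 0)"
    if "i < k" "j < k" for n i j
    using fr[of n] that by (simp add: der_frame_def)
  define G where "G i u = piecewise A (\<lambda>n. D n i u)" for i u
  have G: "G i \<in> Der M" if i: "i < k" for i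
    unfolding G_def
  proof (rule Der_piecewise[OF A D(1)[OF i]])
    show "AE x in M. x \<in> A n \<longrightarrow> \<bar>D n i u x\<bar> \<le> 3 ^ k" if "u \<in> lip_ball M 1" for n u
      using fr[of n] i that by (simp add: der_frame_def)
  qed simp
  have G_in: "G i u x = D n i u x" if "x \<in> A n" for i u x n
    unfolding G_def by (rule piecewise_in[OF A(2) that])
  have "\<forall>i. \<exists>E. i < k \<longrightarrow> E \<in> Der ?R \<and> (\<forall>u\<in>Lip_inf ?R. \<forall>F\<in>Lip_inf M. (\<forall>x\<in>U. F x = u x) \<longrightarrow>
      (AE x in ?R. E u x = G i F x))"
  proof
    fix i
    show "\<exists>E. i < k \<longrightarrow> E \<in> Der ?R \<and> (\<forall>u\<in>Lip_inf ?R. \<forall>F\<in>Lip_inf M. (\<forall>x\<in>U. F x = u x) \<longrightarrow>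
      (AE x in ?R. E u x = G i F x))"
    proof (cases "i < k")
      case True
      from Der_restrict[OF M U G[OF True]] show ?thesis by blast
    qed simp
  qed
  from choice[OF this] obtain E where E': "\<forall>i. i < k \<longrightarrow> E i \<in> Der ?R \<and>
    (\<forall>u\<in>Lip_inf ?R. \<forall>F\<in>Lip_inf M. (\<forall>x\<in>U. F x = u x) \<longrightarrow> (AE x in ?R. E i u x = G i F x))" ..
  have E: "E i \<in> Der ?R" if "i < k" for i using E' that by blast
  have E_eq: "AE x in M. \<forall>i<k. x \<in> U \<longrightarrow> E i u x = G i F x"
    if "u \<in> Lip_inf ?R" "F \<in> Lip_inf M" "\<And>x. x \<in> U \<Longrightarrow> F x = u x" for u F
    using E' that unfolding AE_restrict[OF U] by (intro AE_all_less) blast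
  have AU: "A n \<subseteq> U" for n by (auto simp: U_def)
  have indep: "der_independent ?R k E"
    unfolding der_independent_def
  proof (intro allI impI, elim conjE)
    fix c j assume zero: "der_eq ?R (der_lincomb k c E) (\<lambda>f x. 0)" and j: "j < k"
    have "AE x in M. x \<in> U \<longrightarrow> c j x = 0"
      unfolding U_def
    proof (rule AE_pieces)
      fix n
      have f_R: "f n j \<in> Lip_inf ?R" by (rule Lip_inf_restrict[OF U Lip_infI[OF D(2)[OF j]]])
      have "AE x in M. x \<in> U \<longrightarrow> (\<Sum>i<k. c i x * E i (f n j) x) = 0"
        using zero f_R unfolding der_eq_def AE_restrict[OF U] by (simp add: der_lincomb_def)
      moreover have "AE x in M. \<forall>i<k. x \<in> U \<longrightarrow> E i (f n j) x = G i (f n j) x"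
        by (rule E_eq[OF f_R Lip_infI[OF D(2)[OF j]]]) simp
      moreover have "AE x in M. \<forall>i<k. x \<in> A n \<longrightarrow> D n i (f n j) x = (if i = j then 1 else 0)"
        by (rule AE_all_less) (rule dual[OF _ j])
      ultimately show "AE x in M. x \<in> A n \<longrightarrow> c j x = 0"
      proof eventually_elim
        case (elim x)
        show ?case
        proof
          assume x: "x \<in> A n"
          then have xU: "x \<in> U" using AU by blast
          have "E i (f n j) x = (if i = j then 1 else 0)" if "i < k" for i
            using elim(2,3) that x xU G_in[OF x] by simp
          with elim(1) xU show "c j x = 0" by (simp add: sum_delta_mult[OF j])
        qed
      qed
    qed
    then show "AE x in ?R. c j x = 0" by (simp add: AE_restrict[OF U])
  qed
  have gen: "\<exists>c. (\<forall>i<k. c i \<in> L_inf ?R) \<and> der_eq ?R Q (der_lincomb k c E)"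
    if Q: "Q \<in> Der ?R" for Q
  proof -
    define Q0 where "Q0 = (\<lambda>u x. indicator U x * Q u x)"
    have Q0: "Q0 \<in> Der M" unfolding Q0_def by (rule Der_extend_zero[OF U Q])
    obtain C where C: "0 \<le> C" "\<And>u K. u \<in> lip_ball M K \<Longrightarrow> AE x in M. \<bar>Q0 u x\<bar> \<le> C * K"
      using Der_bounded[OF Q0] by blast
    define c where "c i = (if i < k then piecewise A (\<lambda>n. Q0 (f n i)) else (\<lambda>x. 0))" for i
    have "c i \<in> L_inf ?R" if i: "i < k" for i
    proof (rule L_inf_restrict[OF U])
      show "c i \<in> L_inf M"
        unfolding c_def if_P[OF i]
      proof (rule L_inf_piecewise[OF A _ C(1)])
        show "Q0 (f n i) \<in> L_inf M" for n by (rule Der_L_inf[OF Q0 Lip_infI[OF D(2)[OF i]]])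
        show "AE x in M. x \<in> A n \<longrightarrow> \<bar>Q0 (f n i) x\<bar> \<le> C" for n
          using C(2)[OF D(2)[OF i, of n]] by eventually_elim simp
      qed
    qed
    moreover have "der_eq ?R Q (der_lincomb k c E)"
      unfolding der_eq_def der_lincomb_def
    proof
      fix u assume u: "u \<in> Lip_inf ?R"
      define F where "F = lip_extension M U u"
      have F: "F \<in> Lip_inf M" "\<And>x. x \<in> U \<Longrightarrow> F x = u x"
        unfolding F_def using lip_extension[OF U u] by blast+
      have QF: "AE x in M. x \<in> U \<longrightarrow> Q u x = Q F x"
        using Der_cong_space[OF Q u Lip_inf_restrict[OF U F(1)]] F(2) U
        unfolding AE_restrict[OF U] by simp
      have EF: "AE x in M. \<forall>i<k. x \<in> U \<longrightarrow> E i u x = G i F x" by (rule E_eq[OF u F])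
      have "AE x in M. x \<in> U \<longrightarrow> Q u x = (\<Sum>i<k. c i x * E i u x)"
        unfolding U_def
      proof (rule AE_pieces)
        fix n
        have "AE x in M. x \<in> A n \<longrightarrow> Q0 F x = (\<Sum>i<k. Q0 (f n i) x * D n i F x)"
          using sp[of n] Q0 F(1) by (simp add: der_frame_spans_def)
        with QF EF show "AE x in M. x \<in> A n \<longrightarrow> Q u x = (\<Sum>i<k. c i x * E i u x)"
        proof eventually_elim
          case (elim x)
          show ?case
          proof
            assume x: "x \<in> A n"
            then have xU: "x \<in> U" using AU by blast
            have "Q u x = Q0 F x" using elim(1) xU by (simp add: Q0_def)
            also have "\<dots> = (\<Sum>i<k. Q0 (f n i) x * D n i F x)" using elim(3) x by simp
            also have "\<dots> = (\<Sum>i<k. c i x * E i u x)"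
              using elim(2) xU x
              by (intro sum.cong) (auto simp: c_def piecewise_in[OF A(2) x] G_in[OF x])
            finally show "Q u x = (\<Sum>i<k. c i x * E i u x)" .
          qed
        qed
      qed
      then show "AE x in ?R. Q u x = (\<Sum>i<k. c i x * E i u x)" by (simp add: AE_restrict[OF U])
    qed
    ultimately show ?thesis by blast
  qed
  show ?thesis
    unfolding der_free_of_rank_def U_def[symmetric]
    by (intro exI[of _ E] conjI allI impI ballI E indep gen)
qed

section \<open>The partition\<close>

text \<open>The space is the union of its intersections with the balls of integer radius around any point.\<close>

lemma metric_measure_space_sigma_finite:
  fixes M :: "'a::metric_space measure"
  assumes "metric_measure_space M" shows "sigma_finite_measure M"
proof
  let ?B = "\<lambda>n::nat. space M \<inter> ball undefined (real n)"
  have sets_eq: "sets M = sets (restrict_space borel (space M))"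
    and fin: "\<forall>A\<in>sets M. bounded A \<longrightarrow> emeasure M A < \<infinity>"
    using assms unfolding metric_measure_space_def by blast+
  have B: "?B n \<in> sets M" for n
    unfolding sets_eq sets_restrict_space by (rule imageI) simp
  have finite: "emeasure M (?B n) < \<infinity>" for n
  proof -
    have "bounded (?B n)" by (rule bounded_subset[OF bounded_ball]) auto
    with B[of n] fin show ?thesis by blast
  qed
  have union: "(\<Union>n. ?B n) = space M"
  proof (intro equalityI subsetI)
    fix x assume x: "x \<in> space M"
    obtain n where "dist undefined x < real n" using reals_Archimedean2 by blast
    with x show "x \<in> (\<Union>n. ?B n)" by auto
  qed auto
  show "\<exists>A. countable A \<and> A \<subseteq> sets M \<and> \<Union> A = space M \<and> (\<forall>a\<in>A. emeasure M a \<noteq> \<infinity>)"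
  proof (intro exI conjI)
    show "countable (range ?B)" by simp
    show "range ?B \<subseteq> sets M" using B by blast
    show "\<Union> (range ?B) = space M" by (rule union)
    show "\<forall>a\<in>range ?B. emeasure M a \<noteq> \<infinity>"
    proof
      fix a assume "a \<in> range ?B"
      then obtain n where "a = ?B n" by blast
      with finite[of n] show "emeasure M a \<noteq> \<infinity>" by simp
    qed
  qed
qed

theorem theorem2p41:
  fixes M :: "'a::metric_space measure" and N :: nat
  assumes "metric_measure_space M"
    and "der_index_locally_bounded M N"
  shows "\<exists>(X :: nat \<Rightarrow> 'a set) \<Omega>.
           (\<forall>i\<le>N. X i \<in> sets M) \<and> \<Omega> \<in> sets M \<and>
           space M = (\<Union>i\<le>N. X i) \<union> \<Omega> \<and>
           disjoint_family_on X {..N} \<and> (\<forall>i\<le>N. X i \<inter> \<Omega> = {}) \<and>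
           emeasure M \<Omega> = 0 \<and>
           (\<forall>i\<le>N. X i \<noteq> {} \<longrightarrow> der_free_of_rank (restrict_space M (X i)) i)"
proof -
  note M = assms(1) metric_measure_space_sigma_finite[OF assms(1)]
  define P where "P V \<longleftrightarrow> (\<exists>k D f. k \<le> N \<and> der_frame M V k D f \<and> der_frame_spans M V k D f)" for V
  have P_empty: "P {}" unfolding P_def using der_frame_empty by blast
  have P_subset: "P W" if "P V" "W \<subseteq> V" for V W
  proof -
    from that(1) obtain k D f where
      "k \<le> N" "der_frame M V k D f" "der_frame_spans M V k D f" unfolding P_def by blast
    with der_frame_subset[OF this(2) that(2)] der_frame_spans_subset[OF this(3) that(2)]
    show ?thesis unfolding P_def by blast
  qed
  have P_ex: "\<exists>V. V \<in> sets M \<and> V \<subseteq> U \<and> emeasure M V > 0 \<and> P V"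
    if "U \<in> sets M" "emeasure M U > 0" for U
    using exists_spanning_frame[OF M assms(2) that] unfolding P_def by blast
  obtain A :: "nat \<Rightarrow> 'a set" where A: "range A \<subseteq> sets M" "\<And>n. P (A n)" "disjoint_family A"
    "emeasure M (space M - (\<Union>n. A n)) = 0"
    by (rule disjoint_cover_if_locally_exists[of M P, OF M(2) P_empty P_subset P_ex], assumption+, rule that)
  have "\<forall>n. \<exists>k. k \<le> N \<and> (\<exists>D f. der_frame M (A n) k D f \<and> der_frame_spans M (A n) k D f)"
    using A(2) unfolding P_def by blast
  from choice[OF this] obtain r where
    r: "\<forall>n. r n \<le> N \<and> (\<exists>D f. der_frame M (A n) (r n) D f \<and> der_frame_spans M (A n) (r n) D f)" ..
  \<comment> \<open>Pieces of other ranks are replaced by the empty set, which has spanning frames of every length.\<close>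
  define B where "B i n = (if r n = i then A n else {})" for i n
  define X where "X i = (\<Union>n. B i n)" for i
  define \<Omega> where "\<Omega> = space M - (\<Union>n. A n)"
  have B: "range (B i) \<subseteq> sets M" "disjoint_family (B i)" for i
    using A(1,3) by (auto simp: B_def disjoint_family_on_def)
  have X_sets: "X i \<in> sets M" for i unfolding X_def using B(1)[of i] by auto
  have free: "der_free_of_rank (restrict_space M (X i)) i" for i
    unfolding X_def
  proof (rule der_free_of_rank_if_frames[OF M B])
    fix n
    show "\<exists>D f. der_frame M (B i n) i D f \<and> der_frame_spans M (B i n) i D f"
    proof (cases "r n = i")
      case True
      then show ?thesis using r[rule_format, of n] by (simp add: B_def)
    next
      case False
      then show ?thesis unfolding B_def if_not_P[OF False] using der_frame_empty by blast
    qed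
  qed
  have UX: "(\<Union>i\<le>N. X i) = (\<Union>n. A n)"
    using r by (auto simp: X_def B_def split: if_splits)
  have X_disj: "X i \<inter> X j = {}" if "i \<noteq> j" for i j
  proof (rule ccontr)
    assume "X i \<inter> X j \<noteq> {}"
    then obtain x m n where x: "x \<in> B i m" "x \<in> B j n" by (auto simp: X_def)
    then have "m \<noteq> n" using that by (auto simp: B_def split: if_splits)
    then have "A m \<inter> A n = {}" using A(3) by (simp add: disjoint_family_on_def)
    with x show False by (auto simp: B_def split: if_splits)
  qed
  have UA: "(\<Union>n. A n) \<in> sets M" using A(1) by auto
  show ?thesis
  proof (intro exI conjI allI impI)
    show "X i \<in> sets M" for i by (rule X_sets)
    show "\<Omega> \<in> sets M" unfolding \<Omega>_def using UA by auto
    show "space M = (\<Union>i\<le>N. X i) \<union> \<Omega>"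
      unfolding UX \<Omega>_def using sets.sets_into_space[OF UA] by blast
    show "disjoint_family_on X {..N}" unfolding disjoint_family_on_def using X_disj by blast
    show "X i \<inter> \<Omega> = {}" if "i \<le> N" for i
      using UX that unfolding \<Omega>_def by blast
    show "emeasure M \<Omega> = 0" unfolding \<Omega>_def by (rule A(4))
    show "der_free_of_rank (restrict_space M (X i)) i" for i by (rule free)
  qed
qed

end
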